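(* Let $S$ be a spray on $M$ and let $k$ be an integer with $k\notin\{-1,0\}$. Then $S$ is a Lagrangian vector field induced by a $k$-homogeneous Lagrangian (that is, there exists a $k$-homogeneous function $L\in C^\infty(TM\setminus\{0\})$ with $\mathcal{L}_Sd_JL=dL$) if and only if there exists a $(k-1)$-homogeneous, semi-basic $1$-form $\theta\in\Lambda^1(TM\setminus\{0\})$ such that $$\begin{cases} d_h\theta=0,\ d_J\theta=0, & \text{when } k=1,\\ d_h\theta=0,\ d_J\theta=0,\ \nabla d\theta=0, & \text{when } k\notin\{-1,0,1\}.\end{cases}$$ Here $h$ and $\nabla$ are the horizontal projector and the dynamical covariant derivative induced by $S$, and $J$ is the tangent structure.
   Context: $M$ is a smooth ($C^\infty$) second countable Hausdorff manifold of dimension $n\ge 1$; $\pi:TM\to M$ is the tangent bundle and $TM\setminus\{0\}$ is the tangent bundle with the zero section removed. Coordinates $x^i$ on $M$ induce coordinates $(x^i,y^i)$ on $TM$. All objects are $C^\infty$-smooth. Forms and derivations. $\Lambda^p(TM\setminus\{0\})$ is the module of $p$-forms. For a $(1,1)$-type tensor field $A$ and a $p$-form $\alpha$ with $p\ge 1$, $i_A\alpha(X_1,\dots,X_p)=\sum_{i=1}^p\alpha(X_1,\dots,AX_i,\dots,X_p)$, and $i_A f=0$ for functions $f$. Set $d_A=i_A\circ d-d\circ i_A$. For a vector field $X$, $\mathcal{L}_X$ is the Lie derivative; on a $(1,1)$-tensor $A$, $\mathcal{L}_XA=\mathcal{L}_X\circ A-A\circ\mathcal{L}_X$ (as maps on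 vector fields). Vertical structures. The vertical distribution is $\ker D\pi$. The Liouville vector field is $\mathbb{C}=y^i\frac{\partial}{\partial y^i}$. The tangent structure is the $(1,1)$-tensor $J=\frac{\partial}{\partial y^i}\otimes dx^i$. A $1$-form $\theta$ on $TM\setminus\{0\}$ is semi-basic if it vanishes on vertical vectors (locally $\theta=\theta_i(x,y)dx^i$). Homogeneity. For an integer $m$, a function or $p$-form $\omega$ on $TM\setminus\{0\}$ is $m$-homogeneous if $\mathcal{L}_{\mathbb{C}}\omega=m\omega$. Sprays. A semispray on $M$ is a vector field $S$ on $TM\setminus\{0\}$ with $JS=\mathbb{C}$; it is a spray if moreover $[\mathbb{C},S]=S$. It induces the horizontal and vertical projectors $h=\frac12(\mathrm{Id}-\mathcal{L}_SJ)$, $v=\frac12(\mathrm{Id}+\mathcal{L}_SJ)$. Dynamical covariant derivative. $\nabla$ is the unique tensor derivation on $TM\setminus\{0\}$ (an $\mathbb{R}$-linear, type preserving map of the tensor algebra satisfying the Leibniz rule for $\otimes$ and commuting with contractions) such that $\nabla f=S(f)$ for functions $f$ and $\nabla X=h[S,hX]+v[S,vX]$ for vector fields $X$. Thus for a $p$-form $\omega$, $(\nabla\omega)(X_1,\dots,X_p)=S(\omega(X_1,\dots,X_p))-\sum_{i=1}^p\omega(X_1,\dots,\nabla X_i,\dots,X_p)$. Lagrangians. A Lagrangian is a smooth function $L\in C^\infty(TM\setminus\{0\})$; no regularity is required. Its Poincaré-Cartan $1$-form is $d_JL=\frac{\partial L}{\partial y^i}dx^i$. A semispray $S$ is Lagrangian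 if there is a Lagrangian $L$ with $\mathcal{L}_Sd_JL=dL$. *)

theory Defs
  imports "HOL-Analysis.Analysis" "HOL-Library.Function_Algebras"
begin

section \<open>Smooth maps between Euclidean spaces\<close>

primrec times_diff_on :: "nat \<Rightarrow> 'a::euclidean_space set \<Rightarrow> ('a \<Rightarrow> 'b::euclidean_space) \<Rightarrow> bool" where
  "times_diff_on 0 U f \<longleftrightarrow> continuous_on U f"
| "times_diff_on (Suc r) U f \<longleftrightarrow>
     (\<forall>x\<in>U. f differentiable (at x)) \<and>
     (\<forall>v. times_diff_on r U (\<lambda>x. frechet_derivative f (at x) v))"

text \<open>Only used on open sets \<open>U\<close>; then this is the usual notion, and it depends only on the
  values of \<open>f\<close> on \<open>U\<close>.\<close>

definition smooth_on :: "'a::euclidean_space set \<Rightarrow> ('a \<Rightarrow> 'b::euclidean_space) \<Rightarrow> bool" where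
  "smooth_on U f \<longleftrightarrow> (\<forall>r. times_diff_on r U f)"


section \<open>Manifolds\<close>

text \<open>A chart is a domain with a map that is only relevant on the domain.\<close>

type_synonym ('p, 'e) chart = "'p set \<times> ('p \<Rightarrow> 'e)"

abbreviation chart_dom :: "('p, 'e) chart \<Rightarrow> 'p set" where
  "chart_dom c \<equiv> fst c"

abbreviation chart_map :: "('p, 'e) chart \<Rightarrow> 'p \<Rightarrow> 'e" where
  "chart_map c \<equiv> snd c"

definition chart_img :: "('p, 'e) chart \<Rightarrow> 'e set" where
  "chart_img c = chart_map c ` chart_dom c"

definition chart_inv :: "('p, 'e) chart \<Rightarrow> 'e \<Rightarrow> 'p" where
  "chart_inv c = inv_into (chart_dom c) (chart_map c)"

definition transition :: "('p, 'e) chart \<Rightarrow> ('p, 'e) chart \<Rightarrow> 'e \<Rightarrow> 'e" where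
  "transition c d = chart_map d \<circ> chart_inv c"

definition points :: "('p, 'e) chart set \<Rightarrow> 'p set" where
  "points A = (\<Union>c\<in>A. chart_dom c)"

definition charts_at :: "('p, 'e) chart set \<Rightarrow> 'p \<Rightarrow> ('p, 'e) chart set" where
  "charts_at A p = {c \<in> A. p \<in> chart_dom c}"

definition some_chart :: "('p, 'e) chart set \<Rightarrow> 'p \<Rightarrow> ('p, 'e) chart" where
  "some_chart A p = (SOME c. c \<in> charts_at A p)"

locale smooth_manifold =
  fixes M :: "'m topology" and A :: "('m, 'e::euclidean_space) chart set"
  assumes Hausdorff: "Hausdorff_space M"
    and second_countable: "second_countable M"
    and cover: "points A = topspace M"
    and dom_open: "c \<in> A \<Longrightarrow> openin M (chart_dom c)"
    and img_open: "c \<in> A \<Longrightarrow> open (chart_img c)"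
    and homeo: "c \<in> A \<Longrightarrow>
      homeomorphic_map (subtopology M (chart_dom c)) (top_of_set (chart_img c)) (chart_map c)"
    and compatible: "c \<in> A \<Longrightarrow> d \<in> A \<Longrightarrow>
      smooth_on (chart_map c ` (chart_dom c \<inter> chart_dom d)) (transition c d)"

text \<open>A tangent vector at \<open>p\<close> is the family of its components in all charts around \<open>p\<close>, subject to
  the transformation law. Entries at indices that are not charts around \<open>p\<close> are set to \<open>0\<close>,
  so that a tangent vector is determined by its components; in particular
  the space is \<open>{0}\<close> when \<open>p\<close> is not a point of the manifold.\<close>

type_synonym ('p, 'e) tvec = "('p, 'e) chart \<Rightarrow> 'e"

definition tangent_space :: "('p, 'e::euclidean_space) chart set \<Rightarrow> 'p \<Rightarrow> ('p, 'e) tvec set" where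
  "tangent_space A p = {\<xi>.
     (\<forall>c. c \<notin> charts_at A p \<longrightarrow> \<xi> c = 0) \<and>
     (\<forall>c\<in>charts_at A p. \<forall>d\<in>charts_at A p.
        \<xi> d = frechet_derivative (transition c d) (at (chart_map c p)) (\<xi> c))}"

text \<open>Differential at \<open>p\<close> of a map \<open>F\<close> from the manifold with atlas \<open>B\<close> to the one with
  atlas \<open>A\<close>.\<close>

definition tangent_map ::
  "('q, 'f::euclidean_space) chart set \<Rightarrow> ('p, 'e::euclidean_space) chart set \<Rightarrow> ('q \<Rightarrow> 'p) \<Rightarrow> 'q
     \<Rightarrow> ('q, 'f) tvec \<Rightarrow> ('p, 'e) tvec" where
  "tangent_map B A F p \<xi> = (\<lambda>c. if c \<in> charts_at A (F p)
     then (let b = some_chart B p in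
       frechet_derivative (chart_map c \<circ> F \<circ> chart_inv b) (at (chart_map b p)) (\<xi> b))
     else 0)"


section \<open>Functions, vector fields and forms\<close>

text \<open>Functions on the manifold are extended by \<open>0\<close> to the whole type, and so are vector fields
  (by the convention for tangent vectors). Equality of functions or fields on the
  manifold is thus equality in HOL.\<close>

definition smooth_functions :: "('p, 'e::euclidean_space) chart set \<Rightarrow> ('p \<Rightarrow> real) set" where
  "smooth_functions A = {f. (\<forall>p. p \<notin> points A \<longrightarrow> f p = 0) \<and>
     (\<forall>c\<in>A. smooth_on (chart_img c) (\<lambda>x. f (chart_inv c x)))}"

type_synonym ('p, 'e) vfield = "'p \<Rightarrow> ('p, 'e) tvec"

definition vector_fields :: "('p, 'e::euclidean_space) chart set \<Rightarrow> ('p, 'e) vfield set" where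
  "vector_fields A = {X. (\<forall>p. X p \<in> tangent_space A p) \<and>
     (\<forall>c\<in>A. smooth_on (chart_img c) (\<lambda>x. X (chart_inv c x) c))}"

text \<open>Sums and differences of functions and of vector fields, and products of functions, are the
  pointwise ones of the theory \<open>Function_Algebras\<close>.\<close>

definition vf_scale :: "('p \<Rightarrow> real) \<Rightarrow> ('p, 'e::euclidean_space) vfield \<Rightarrow> ('p, 'e) vfield" where
  "vf_scale f X = (\<lambda>p c. f p *\<^sub>R X p c)"

definition vf_apply ::
  "('p, 'e::euclidean_space) chart set \<Rightarrow> ('p, 'e) vfield \<Rightarrow> ('p \<Rightarrow> real) \<Rightarrow> 'p \<Rightarrow> real" where
  "vf_apply A X f = (\<lambda>p. if p \<in> points A
     then (let c = some_chart A p in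
       frechet_derivative (f \<circ> chart_inv c) (at (chart_map c p)) (X p c))
     else 0)"

text \<open>In each chart, \<open>[X,Y]\<^sup>i = X\<^sup>j \<partial>\<^sub>jY\<^sup>i - Y\<^sup>j \<partial>\<^sub>jX\<^sup>i\<close>.\<close>

definition lie_bracket ::
  "('p, 'e::euclidean_space) chart set \<Rightarrow> ('p, 'e) vfield \<Rightarrow> ('p, 'e) vfield \<Rightarrow> ('p, 'e) vfield" where
  "lie_bracket A X Y = (\<lambda>p c. if c \<in> charts_at A p
     then frechet_derivative (\<lambda>x. Y (chart_inv c x) c) (at (chart_map c p)) (X p c)
        - frechet_derivative (\<lambda>x. X (chart_inv c x) c) (at (chart_map c p)) (Y p c)
     else 0)"

text \<open>Tensor fields are maps on vector fields that are linear over the smooth functions: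
  \<open>(1,1)\<close>-tensors are maps from vector fields to vector fields, and \<open>p\<close>-forms are multilinear
  alternating maps taking \<open>p\<close> vector fields to a function (\<open>0\<close>-forms are functions).
  Degrees \<open>0\<close>, \<open>1\<close>, \<open>2\<close> are all that is needed below. Only values on
  elements of \<^const>\<open>vector_fields\<close> are relevant.\<close>

type_synonym ('p, 'e) tensor11 = "('p, 'e) vfield \<Rightarrow> ('p, 'e) vfield"
type_synonym ('p, 'e) form1 = "('p, 'e) vfield \<Rightarrow> 'p \<Rightarrow> real"
type_synonym ('p, 'e) form2 = "('p, 'e) vfield \<Rightarrow> ('p, 'e) vfield \<Rightarrow> 'p \<Rightarrow> real"

definition one_forms :: "('p, 'e::euclidean_space) chart set \<Rightarrow> ('p, 'e) form1 set" where
  "one_forms A = {\<theta>.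
     (\<forall>X\<in>vector_fields A. \<theta> X \<in> smooth_functions A) \<and>
     (\<forall>X\<in>vector_fields A. \<forall>Y\<in>vector_fields A. \<theta> (X + Y) = \<theta> X + \<theta> Y) \<and>
     (\<forall>f\<in>smooth_functions A. \<forall>X\<in>vector_fields A. \<theta> (vf_scale f X) = f * \<theta> X)}"

definition form1_eq ::
  "('p, 'e::euclidean_space) chart set \<Rightarrow> ('p, 'e) form1 \<Rightarrow> ('p, 'e) form1 \<Rightarrow> bool" where
  "form1_eq A \<alpha> \<beta> \<longleftrightarrow> (\<forall>X\<in>vector_fields A. \<alpha> X = \<beta> X)"

definition form2_zero :: "('p, 'e::euclidean_space) chart set \<Rightarrow> ('p, 'e) form2 \<Rightarrow> bool" where
  "form2_zero A \<omega> \<longleftrightarrow> (\<forall>X\<in>vector_fields A. \<forall>Y\<in>vector_fields A. \<omega> X Y = 0)"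

definition ext_d0 ::
  "('p, 'e::euclidean_space) chart set \<Rightarrow> ('p \<Rightarrow> real) \<Rightarrow> ('p, 'e) form1" where
  "ext_d0 A f = (\<lambda>X. vf_apply A X f)"

definition ext_d1 ::
  "('p, 'e::euclidean_space) chart set \<Rightarrow> ('p, 'e) form1 \<Rightarrow> ('p, 'e) form2" where
  "ext_d1 A \<theta> = (\<lambda>X Y. vf_apply A X (\<theta> Y) - vf_apply A Y (\<theta> X) - \<theta> (lie_bracket A X Y))"

definition insert0 :: "('p, 'e) tensor11 \<Rightarrow> ('p \<Rightarrow> real) \<Rightarrow> ('p \<Rightarrow> real)" where
  "insert0 K f = 0"

definition insert1 :: "('p, 'e) tensor11 \<Rightarrow> ('p, 'e) form1 \<Rightarrow> ('p, 'e) form1" where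
  "insert1 K \<theta> = (\<lambda>X. \<theta> (K X))"

definition insert2 :: "('p, 'e) tensor11 \<Rightarrow> ('p, 'e) form2 \<Rightarrow> ('p, 'e) form2" where
  "insert2 K \<omega> = (\<lambda>X Y. \<omega> (K X) Y + \<omega> X (K Y))"

text \<open>The derivations \<open>d\<^sub>K = i\<^sub>K d - d i\<^sub>K\<close> on functions and on \<open>1\<close>-forms.\<close>

definition d_along0 ::
  "('p, 'e::euclidean_space) chart set \<Rightarrow> ('p, 'e) tensor11 \<Rightarrow> ('p \<Rightarrow> real) \<Rightarrow> ('p, 'e) form1" where
  "d_along0 A K f = insert1 K (ext_d0 A f) - ext_d0 A (insert0 K f)"

definition d_along1 ::
  "('p, 'e::euclidean_space) chart set \<Rightarrow> ('p, 'e) tensor11 \<Rightarrow> ('p, 'e) form1 \<Rightarrow> ('p, 'e) form2" where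
  "d_along1 A K \<theta> = insert2 K (ext_d1 A \<theta>) - ext_d1 A (insert1 K \<theta>)"

definition lie_form1 ::
  "('p, 'e::euclidean_space) chart set \<Rightarrow> ('p, 'e) vfield \<Rightarrow> ('p, 'e) form1 \<Rightarrow> ('p, 'e) form1" where
  "lie_form1 A X \<theta> = (\<lambda>Y. vf_apply A X (\<theta> Y) - \<theta> (lie_bracket A X Y))"

definition lie_tensor ::
  "('p, 'e::euclidean_space) chart set \<Rightarrow> ('p, 'e) vfield \<Rightarrow> ('p, 'e) tensor11 \<Rightarrow> ('p, 'e) tensor11" where
  "lie_tensor A X K = (\<lambda>Y. lie_bracket A X (K Y) - K (lie_bracket A X Y))"


section \<open>The slit tangent bundle\<close>

text \<open>For an atlas \<open>A\<close> of \<open>M\<close>, the manifold \<open>TM \<setminus> {0}\<close> is given by its induced atlas, whose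
  charts are \<open>(p, \<xi>) \<mapsto> (x\<^sup>i, y\<^sup>i)\<close>; the bundle projection is \<^const>\<open>fst\<close>. The notions
  above do not refer to the topology, which for \<open>TM \<setminus> {0}\<close> is the one
  determined by this atlas.\<close>

type_synonym ('m, 'e) tpoint = "'m \<times> ('m, 'e) tvec"

definition slit_chart ::
  "('m, 'e::euclidean_space) chart set \<Rightarrow> ('m, 'e) chart \<Rightarrow> (('m, 'e) tpoint, 'e \<times> 'e) chart" where
  "slit_chart A c =
     ({(p, \<xi>). p \<in> chart_dom c \<and> \<xi> \<in> tangent_space A p \<and> \<xi> \<noteq> 0},
      \<lambda>(p, \<xi>). (chart_map c p, \<xi> c))"

definition slit_atlas ::
  "('m, 'e::euclidean_space) chart set \<Rightarrow> (('m, 'e) tpoint, 'e \<times> 'e) chart set" where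
  "slit_atlas A = slit_chart A ` A"

type_synonym ('m, 'e) slit_vfield = "(('m, 'e) tpoint, 'e \<times> 'e) vfield"
type_synonym ('m, 'e) slit_tensor11 = "(('m, 'e) tpoint, 'e \<times> 'e) tensor11"
type_synonym ('m, 'e) slit_form1 = "(('m, 'e) tpoint, 'e \<times> 'e) form1"
type_synonym ('m, 'e) slit_form2 = "(('m, 'e) tpoint, 'e \<times> 'e) form2"

definition vertical_fields ::
  "('m, 'e::euclidean_space) chart set \<Rightarrow> ('m, 'e) slit_vfield set" where
  "vertical_fields A = {X \<in> vector_fields (slit_atlas A).
     \<forall>u\<in>points (slit_atlas A). tangent_map (slit_atlas A) A fst u (X u) = 0}"

definition semi_basic ::
  "('m, 'e::euclidean_space) chart set \<Rightarrow> ('m, 'e) slit_form1 \<Rightarrow> bool" where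
  "semi_basic A \<theta> \<longleftrightarrow> (\<forall>X\<in>vertical_fields A. \<theta> X = 0)"

text \<open>In an induced chart, \<open>\<partial>/\<partial>x\<^sup>i\<close> and \<open>\<partial>/\<partial>y\<^sup>i\<close> span the two factors of \<open>'e \<times> 'e\<close>: the Liouville
  field has components \<open>(0, y)\<close>, and \<open>J\<close> maps \<open>(a, b)\<close> to \<open>(0, a)\<close>.\<close>

definition liouville :: "('m, 'e::euclidean_space) chart set \<Rightarrow> ('m, 'e) slit_vfield" where
  "liouville A = (\<lambda>u c. if c \<in> charts_at (slit_atlas A) u then (0, snd (chart_map c u)) else 0)"

definition tangent_structure :: "('m, 'e::euclidean_space) slit_tensor11" where
  "tangent_structure X = (\<lambda>u c. (0, fst (X u c)))"

definition homogeneous_function ::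
  "('m, 'e::euclidean_space) chart set \<Rightarrow> int \<Rightarrow> (('m, 'e) tpoint \<Rightarrow> real) \<Rightarrow> bool" where
  "homogeneous_function A m f \<longleftrightarrow>
     vf_apply (slit_atlas A) (liouville A) f = (\<lambda>u. real_of_int m * f u)"

definition homogeneous_form1 ::
  "('m, 'e::euclidean_space) chart set \<Rightarrow> int \<Rightarrow> ('m, 'e) slit_form1 \<Rightarrow> bool" where
  "homogeneous_form1 A m \<theta> \<longleftrightarrow>
     form1_eq (slit_atlas A) (lie_form1 (slit_atlas A) (liouville A) \<theta>)
       (\<lambda>X u. real_of_int m * \<theta> X u)"


section \<open>Sprays and Lagrangians\<close>

definition semispray ::
  "('m, 'e::euclidean_space) chart set \<Rightarrow> ('m, 'e) slit_vfield \<Rightarrow> bool" where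
  "semispray A S \<longleftrightarrow> S \<in> vector_fields (slit_atlas A) \<and> tangent_structure S = liouville A"

definition spray ::
  "('m, 'e::euclidean_space) chart set \<Rightarrow> ('m, 'e) slit_vfield \<Rightarrow> bool" where
  "spray A S \<longleftrightarrow> semispray A S \<and> lie_bracket (slit_atlas A) (liouville A) S = S"

definition hor_proj ::
  "('m, 'e::euclidean_space) chart set \<Rightarrow> ('m, 'e) slit_vfield \<Rightarrow> ('m, 'e) slit_tensor11" where
  "hor_proj A S X = vf_scale (\<lambda>_. 1/2) (X - lie_tensor (slit_atlas A) S tangent_structure X)"

definition ver_proj ::
  "('m, 'e::euclidean_space) chart set \<Rightarrow> ('m, 'e) slit_vfield \<Rightarrow> ('m, 'e) slit_tensor11" where
  "ver_proj A S X = vf_scale (\<lambda>_. 1/2) (X + lie_tensor (slit_atlas A) S tangent_structure X)"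

definition nabla_field ::
  "('m, 'e::euclidean_space) chart set \<Rightarrow> ('m, 'e) slit_vfield
     \<Rightarrow> ('m, 'e) slit_vfield \<Rightarrow> ('m, 'e) slit_vfield" where
  "nabla_field A S X =
     hor_proj A S (lie_bracket (slit_atlas A) S (hor_proj A S X)) +
     ver_proj A S (lie_bracket (slit_atlas A) S (ver_proj A S X))"

definition nabla_form2 ::
  "('m, 'e::euclidean_space) chart set \<Rightarrow> ('m, 'e) slit_vfield
     \<Rightarrow> ('m, 'e) slit_form2 \<Rightarrow> ('m, 'e) slit_form2" where
  "nabla_form2 A S \<omega> = (\<lambda>X Y. vf_apply (slit_atlas A) S (\<omega> X Y)
     - \<omega> (nabla_field A S X) Y - \<omega> X (nabla_field A S Y))"

definition poincare_cartan ::
  "('m, 'e::euclidean_space) chart set \<Rightarrow> (('m, 'e) tpoint \<Rightarrow> real) \<Rightarrow> ('m, 'e) slit_form1" where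
  "poincare_cartan A L = d_along0 (slit_atlas A) tangent_structure L"

definition lagrangian_induces ::
  "('m, 'e::euclidean_space) chart set \<Rightarrow> (('m, 'e) tpoint \<Rightarrow> real) \<Rightarrow> ('m, 'e) slit_vfield \<Rightarrow> bool" where
  "lagrangian_induces A L S \<longleftrightarrow> L \<in> smooth_functions (slit_atlas A) \<and>
     form1_eq (slit_atlas A) (lie_form1 (slit_atlas A) S (poincare_cartan A L))
       (ext_d0 (slit_atlas A) L)"

end

theory Submission
  imports Defs
begin

text \<open>Write \<open>\<Gamma> = \<L>\<^sub>S J\<close>, so that \<open>h = (Id - \<Gamma>)/2\<close> and \<open>v = (Id + \<Gamma>)/2\<close>. Both directions identify \<open>\<theta>\<close> with the
Poincare-Cartan form \<open>d\<^sub>J L\<close>; everything then follows from brackets with the spray \<open>S\<close>, the Liouville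
field \<open>\<C>\<close> and \<open>J\<close>. A form that kills vertical fields only sees \<open>J X\<close>, and for vertical \<open>Z\<close> one has
\<open>J[S,Z] = -Z\<close>; this one identity yields \<open>\<Gamma>\<^sup>2 = Id\<close>, \<open>J h = J\<close>, \<open>J v = 0\<close>, and, with \<open>[\<C>,S] = S\<close>, also
\<open>h S = S\<close> and \<open>\<nabla> \<C> = 0\<close>.

From \<open>L\<close> to \<open>\<theta> = d\<^sub>J L\<close> (\<open>lagrangian_imp_form\<close>). Put \<open>\<omega> = d\<theta>\<close>. Integrability of \<open>J\<close> gives
\<open>i\<^sub>J \<omega> = d\<^sub>J \<theta> = 0\<close>, and \<open>\<L>\<^sub>S \<theta> = dL\<close> gives \<open>\<L>\<^sub>S \<omega> = 0\<close> because \<open>d d = 0\<close>. Differentiating \<open>i\<^sub>J \<omega> = 0\<close>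
along \<open>S\<close> yields \<open>i\<^sub>\<Gamma> \<omega> = 0\<close>, which is the same as \<open>i\<^sub>h \<omega> = \<omega>\<close>, that is \<open>d\<^sub>h \<theta> = 0\<close>
(\<open>invariant_d_h\<close>). Hence the horizontal and the vertical distribution are both isotropic for
\<open>\<omega>\<close>. The derivations \<open>\<L>\<^sub>S\<close> and \<open>\<nabla>\<close> differ only by the terms \<open>v[S,hX]\<close> and \<open>h[S,vX]\<close> that change
the type of a vector, and by isotropy these do not contribute to
\<open>\<L>\<^sub>S \<omega>\<close> on pairs of opposite type; so \<open>\<nabla> \<omega> = \<L>\<^sub>S \<omega> = 0\<close> (\<open>invariant_nabla\<close>).

From \<open>\<theta>\<close> to \<open>L\<close> (\<open>form_imp_lagrangian\<close>). Euler's theorem suggests \<open>L = \<theta>(S)/k\<close>. Homogeneity gives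
\<open>i\<^sub>\<C> d\<theta> = (k - 1) \<theta>\<close>, and evaluating \<open>d\<^sub>J \<theta> = 0\<close> on \<open>(S, Y)\<close> turns this into \<open>JY(\<theta>(S)) = k \<theta>(Y)\<close>, that
is \<open>d\<^sub>J L = \<theta>\<close>. It remains to compare \<open>\<L>\<^sub>S \<theta>\<close> with \<open>dL\<close> on \<open>X = hX + vX\<close>. On \<open>vX = J(-[S,vX])\<close> they agree by
\<open>d\<^sub>J L = \<theta>\<close>. On \<open>hX\<close>, the value of \<open>d\<^sub>h \<theta> = 0\<close> on \<open>(S,X)\<close> is \<open>d\<theta>(S,hX) = 0\<close>, whence
\<open>(\<L>\<^sub>S \<theta>)(hX) = hX(\<theta>(S)) = k hX(L)\<close>. For \<open>k = 1\<close> this is the claim. For \<open>k \<noteq> 1\<close>, contracting \<open>\<nabla> d\<theta> = 0\<close>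
with \<open>\<C>\<close> shows \<open>(k - 1) \<nabla>\<theta> = 0\<close>, so \<open>(\<L>\<^sub>S \<theta>)(hX) = (\<nabla>\<theta>)(hX) = 0\<close> and both sides vanish.

The geometry rests on calculus in charts: smooth maps are closed under the usual
operations, and the symmetry of second derivatives (\<open>second_deriv_symmetric\<close>) makes the bracket a vector
field (\<open>bracket_VF\<close>) with the Jacobi identity (\<open>jacobi\<close>). These facts are proved for an arbitrary
atlas and used for the atlas that the manifold induces on its slit tangent bundle
(\<open>smooth_atlas_slit\<close>).\<close>

section \<open>Calculus of smooth maps\<close>

abbreviation deriv_at :: "('a::euclidean_space \<Rightarrow> 'b::euclidean_space) \<Rightarrow> 'a \<Rightarrow> 'a \<Rightarrow> 'b" where
  "deriv_at f x \<equiv> frechet_derivative f (at x)"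

lemma deriv_at_eqI: "(f has_derivative f') (at x) \<Longrightarrow> deriv_at f x = f'"
  using frechet_derivative_at by metis

lemma has_deriv_at: "f differentiable (at x) \<Longrightarrow> (f has_derivative deriv_at f x) (at x)"
  by (simp add: frechet_derivative_works)

lemma deriv_at_cong:
  assumes "open U" "x \<in> U" "\<And>z. z \<in> U \<Longrightarrow> f z = g z"
  shows "deriv_at f x = deriv_at g x"
proof -
  have *: "(f has_derivative D) (at x) \<longleftrightarrow> (g has_derivative D) (at x)" for D
    using has_derivative_transform_within_open[of f D x UNIV U g]
      has_derivative_transform_within_open[of g D x UNIV U f] assms by auto
  show ?thesis unfolding frechet_derivative_def * ..
qed

lemma differentiable_cong_open:
  assumes "open U" "x \<in> U" "\<And>z. z \<in> U \<Longrightarrow> f z = g z" "f differentiable (at x)"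
  shows "g differentiable (at x)"
  using assms has_derivative_transform_within_open unfolding differentiable_def by blast

lemma times_diff_on_cong:
  assumes "open U" "\<And>x. x \<in> U \<Longrightarrow> f x = g x"
  shows "times_diff_on r U f \<longleftrightarrow> times_diff_on r U g"
  using assms(2)
proof (induction r arbitrary: f g)
  case 0
  then show ?case by (simp cong: continuous_on_cong)
next
  case (Suc r)
  have "times_diff_on r U (\<lambda>x. deriv_at f x v) \<longleftrightarrow> times_diff_on r U (\<lambda>x. deriv_at g x v)" for v
    using Suc.prems by (intro Suc.IH) (metis deriv_at_cong[OF assms(1)])
  moreover have "f differentiable (at x) \<longleftrightarrow> g differentiable (at x)" if "x \<in> U" for x
    using differentiable_cong_open[OF assms(1) that, of f g]
      differentiable_cong_open[OF assms(1) that, of g f] Suc.prems by auto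
  ultimately show ?case by auto
qed

lemma times_diff_on_transform:
  "times_diff_on r U f \<Longrightarrow> open U \<Longrightarrow> (\<And>x. x \<in> U \<Longrightarrow> f x = g x) \<Longrightarrow> times_diff_on r U g"
  using times_diff_on_cong by blast

lemma times_diff_on_Suc_imp: "times_diff_on (Suc r) U f \<Longrightarrow> times_diff_on r U f"
proof (induction r arbitrary: f)
  case 0
  then show ?case
    by (auto intro!: continuous_at_imp_continuous_on differentiable_imp_continuous_within)
qed auto

lemma times_diff_on_linear_compose:
  assumes "open U" "bounded_linear l" "times_diff_on r U f"
  shows "times_diff_on r U (\<lambda>x. l (f x))"
  using assms(3)
proof (induction r arbitrary: f)
  case 0
  then show ?case by (simp add: bounded_linear.continuous_on[OF assms(2)])
next
  case (Suc r)
  have d: "((\<lambda>x. l (f x)) has_derivative (\<lambda>v. l (deriv_at f x v))) (at x)" if "x \<in> U" for x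
    using Suc.prems that by (auto intro!: bounded_linear.has_derivative[OF assms(2)] has_deriv_at)
  have "times_diff_on r U (\<lambda>x. deriv_at (\<lambda>x. l (f x)) x v)" for v
  proof -
    have "times_diff_on r U (\<lambda>x. l (deriv_at f x v))" using Suc by auto
    then show ?thesis
      by (rule times_diff_on_transform[OF _ assms(1)]) (simp add: deriv_at_eqI[OF d])
  qed
  then show ?case using d by (auto simp: differentiable_def)
qed

lemma times_diff_on_add:
  assumes "open U" "times_diff_on r U f" "times_diff_on r U g"
  shows "times_diff_on r U (\<lambda>x. f x + g x)"
  using assms(2,3)
proof (induction r arbitrary: f g)
  case 0
  then show ?case by (simp add: continuous_on_add)
next
  case (Suc r)
  have d: "((\<lambda>x. f x + g x) has_derivative (\<lambda>v. deriv_at f x v + deriv_at g x v)) (at x)"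
    if "x \<in> U" for x
    using Suc.prems that by (auto intro!: has_derivative_add has_deriv_at)
  have "times_diff_on r U (\<lambda>x. deriv_at (\<lambda>x. f x + g x) x v)" for v
  proof -
    have "times_diff_on r U (\<lambda>x. deriv_at f x v + deriv_at g x v)" using Suc by auto
    then show ?thesis
      by (rule times_diff_on_transform[OF _ assms(1)]) (simp add: deriv_at_eqI[OF d])
  qed
  then show ?case using d by (auto simp: differentiable_def)
qed

lemma times_diff_on_bilinear:
  assumes "open U" "bounded_bilinear b" "times_diff_on r U f" "times_diff_on r U g"
  shows "times_diff_on r U (\<lambda>x. b (f x) (g x))"
  using assms(3,4)
proof (induction r arbitrary: f g)
  case 0
  then show ?case by (simp add: bounded_bilinear.continuous_on[OF assms(2)])
next
  case (Suc r)
  have d: "((\<lambda>x. b (f x) (g x)) has_derivative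
      (\<lambda>v. b (f x) (deriv_at g x v) + b (deriv_at f x v) (g x))) (at x)"
    if "x \<in> U" for x
    using Suc.prems that by (auto intro!: bounded_bilinear.FDERIV[OF assms(2)] has_deriv_at)
  have "times_diff_on r U (\<lambda>x. deriv_at (\<lambda>x. b (f x) (g x)) x v)" for v
  proof -
    have "times_diff_on r U (\<lambda>x. b (f x) (deriv_at g x v) + b (deriv_at f x v) (g x))"
      using Suc.prems Suc.prems[THEN times_diff_on_Suc_imp]
      by (intro times_diff_on_add assms(1) Suc.IH) auto
    then show ?thesis
      by (rule times_diff_on_transform[OF _ assms(1)]) (simp add: deriv_at_eqI[OF d])
  qed
  then show ?case using d by (auto simp: differentiable_def)
qed

lemma times_diff_on_const: "times_diff_on r U (\<lambda>x. c)"
  by (induction r arbitrary: c) auto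

lemma times_diff_on_sum:
  assumes "open U" "finite I" "\<And>i. i \<in> I \<Longrightarrow> times_diff_on r U (f i)"
  shows "times_diff_on r U (\<lambda>x. \<Sum>i\<in>I. f i x)"
  using assms(2,3)
  by (induction I rule: finite_induct) (auto intro: times_diff_on_const times_diff_on_add[OF assms(1)])

lemma linear_basis_expansion:
  assumes "linear l"
  shows "l v = (\<Sum>b\<in>Basis. (v \<bullet> b) *\<^sub>R l b)"
proof -
  have "l v = l (\<Sum>b\<in>Basis. (v \<bullet> b) *\<^sub>R b)" by (simp add: euclidean_representation)
  also have "\<dots> = (\<Sum>b\<in>Basis. (v \<bullet> b) *\<^sub>R l b)"
    using assms by (simp add: linear_sum linear_cmul)
  finally show ?thesis .
qed

lemma deriv_at_basis_expansion:
  assumes "f differentiable (at x)"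
  shows "deriv_at f x v = (\<Sum>b\<in>Basis. (v \<bullet> b) *\<^sub>R deriv_at f x b)"
  using linear_basis_expansion[OF linear_frechet_derivative[OF assms]] .

text \<open>The chain rule involves the derivative of \<open>g\<close> in the moving direction \<open>deriv_at f x v\<close>, whereas the
induction hypothesis speaks of fixed directions only. Expanding that direction in the basis
reduces the one to the other; the same device serves below for derivatives in
a varying direction.\<close>

lemma times_diff_on_compose:
  assumes "open U" "open V" "times_diff_on r U f" "times_diff_on r V g" "f ` U \<subseteq> V"
  shows "times_diff_on r U (\<lambda>x. g (f x))"
  using assms(3,4)
proof (induction r arbitrary: g)
  case 0
  then show ?case using continuous_on_compose2[of V g U f] assms(5) by simp
next
  case (Suc r)
  have gd: "g differentiable (at (f x))" if "x \<in> U" for x using Suc.prems that assms(5) by auto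
  have d: "((\<lambda>x. g (f x)) has_derivative (\<lambda>v. deriv_at g (f x) (deriv_at f x v))) (at x)"
    if "x \<in> U" for x
    using diff_chain_at[of f "deriv_at f x" x g "deriv_at g (f x)"] Suc.prems that
    by (simp add: o_def has_deriv_at gd)
  have "times_diff_on r U (\<lambda>x. deriv_at (\<lambda>x. g (f x)) x v)" for v
  proof -
    have f: "times_diff_on r U f" using Suc.prems times_diff_on_Suc_imp by blast
    have "times_diff_on r U (\<lambda>x. \<Sum>b\<in>Basis. (deriv_at f x v \<bullet> b) *\<^sub>R deriv_at g (f x) b)"
    proof (intro times_diff_on_sum assms(1) finite_Basis)
      fix b :: 'b assume "b \<in> Basis"
      have "times_diff_on r U (\<lambda>x. deriv_at g (f x) b)"
        using Suc.IH[OF f, of "\<lambda>y. deriv_at g y b"] Suc.prems by simp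
      moreover have "times_diff_on r U (\<lambda>x. deriv_at f x v \<bullet> b)"
        using Suc.prems
        by (intro times_diff_on_linear_compose[OF assms(1) bounded_linear_inner_left]) auto
      ultimately show "times_diff_on r U (\<lambda>x. (deriv_at f x v \<bullet> b) *\<^sub>R deriv_at g (f x) b)"
        by (intro times_diff_on_bilinear[OF assms(1) bounded_bilinear_scaleR])
    qed
    moreover have "(\<Sum>b\<in>Basis. (deriv_at f x v \<bullet> b) *\<^sub>R deriv_at g (f x) b)
        = deriv_at (\<lambda>x. g (f x)) x v" if "x \<in> U" for x
      using deriv_at_eqI[OF d[OF that]] deriv_at_basis_expansion[OF gd[OF that], of "deriv_at f x v"] by simp
    ultimately show ?thesis
      by (rule times_diff_on_transform[OF _ assms(1)])
  qed
  then show ?case using d by (auto simp: differentiable_def)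
qed

lemma smooth_on_transform:
  "smooth_on U f \<Longrightarrow> open U \<Longrightarrow> (\<And>x. x \<in> U \<Longrightarrow> f x = g x) \<Longrightarrow> smooth_on U g"
  unfolding smooth_on_def using times_diff_on_transform by blast

lemma smooth_on_differentiable: "smooth_on U f \<Longrightarrow> x \<in> U \<Longrightarrow> f differentiable (at x)"
  unfolding smooth_on_def using times_diff_on.simps(2) by blast

lemma smooth_on_deriv: "smooth_on U f \<Longrightarrow> smooth_on U (\<lambda>x. deriv_at f x v)"
  unfolding smooth_on_def using times_diff_on.simps(2) by blast

lemma smooth_on_continuous: "smooth_on U f \<Longrightarrow> continuous_on U f"
  unfolding smooth_on_def using times_diff_on.simps(1) by blast

lemma smooth_on_const: "smooth_on U (\<lambda>x. c)"
  unfolding smooth_on_def by (simp add: times_diff_on_const)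

lemma smooth_on_linear_compose:
  "open U \<Longrightarrow> bounded_linear l \<Longrightarrow> smooth_on U f \<Longrightarrow> smooth_on U (\<lambda>x. l (f x))"
  unfolding smooth_on_def by (simp add: times_diff_on_linear_compose)

lemma smooth_on_id: "smooth_on U (\<lambda>x. x)"
proof -
  have "times_diff_on r U (\<lambda>x. x)" for r
    by (cases r) (auto simp: times_diff_on_const)
  then show ?thesis unfolding smooth_on_def by blast
qed

lemma smooth_on_linear: "open U \<Longrightarrow> bounded_linear l \<Longrightarrow> smooth_on U l"
  using smooth_on_linear_compose[OF _ _ smooth_on_id] by blast

lemma smooth_on_add: "open U \<Longrightarrow> smooth_on U f \<Longrightarrow> smooth_on U g \<Longrightarrow> smooth_on U (\<lambda>x. f x + g x)"
  unfolding smooth_on_def by (simp add: times_diff_on_add)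

lemma smooth_on_bilinear:
  "open U \<Longrightarrow> bounded_bilinear b \<Longrightarrow> smooth_on U f \<Longrightarrow> smooth_on U g \<Longrightarrow> smooth_on U (\<lambda>x. b (f x) (g x))"
  unfolding smooth_on_def by (simp add: times_diff_on_bilinear)

lemma smooth_on_diff:
  "open U \<Longrightarrow> smooth_on U f \<Longrightarrow> smooth_on U g \<Longrightarrow> smooth_on U (\<lambda>x. f x - g x)"
  using smooth_on_add[of U f "\<lambda>x. - g x"] smooth_on_linear_compose[of U uminus g]
  by (simp add: bounded_linear_minus[OF bounded_linear_ident])

lemma smooth_on_sum:
  "open U \<Longrightarrow> finite I \<Longrightarrow> (\<And>i. i \<in> I \<Longrightarrow> smooth_on U (f i)) \<Longrightarrow> smooth_on U (\<lambda>x. \<Sum>i\<in>I. f i x)"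
  unfolding smooth_on_def by (simp add: times_diff_on_sum)

lemma smooth_on_compose:
  "open U \<Longrightarrow> open V \<Longrightarrow> smooth_on U f \<Longrightarrow> smooth_on V g \<Longrightarrow> f ` U \<subseteq> V \<Longrightarrow> smooth_on U (\<lambda>x. g (f x))"
  unfolding smooth_on_def using times_diff_on_compose by blast

lemma smooth_on_Pair:
  assumes "open U" "smooth_on U f" "smooth_on U g"
  shows "smooth_on U (\<lambda>x. (f x, g x))"
proof -
  have l: "bounded_linear (\<lambda>x::'b. (x, 0::'c))" "bounded_linear (\<lambda>x::'c. (0::'b, x))"
    by (rule bounded_linear_Pair[OF bounded_linear_ident bounded_linear_zero],
        rule bounded_linear_Pair[OF bounded_linear_zero bounded_linear_ident])
  have "smooth_on U (\<lambda>x. (f x, 0) + (0, g x))"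
    by (rule smooth_on_add[OF assms(1) smooth_on_linear_compose[OF assms(1) l(1) assms(2)]
          smooth_on_linear_compose[OF assms(1) l(2) assms(3)]])
  then show ?thesis by simp
qed

lemma smooth_on_deriv_apply:
  assumes "open U" "open V" "smooth_on V f" "smooth_on U g" "g ` U \<subseteq> V" "smooth_on U h"
  shows "smooth_on U (\<lambda>x. deriv_at f (g x) (h x))"
proof (rule smooth_on_transform[OF _ assms(1)])
  show "smooth_on U (\<lambda>x. \<Sum>b\<in>Basis. (h x \<bullet> b) *\<^sub>R deriv_at f (g x) b)"
  proof (intro smooth_on_sum assms(1) finite_Basis)
    fix b :: 'b assume "b \<in> Basis"
    show "smooth_on U (\<lambda>x. (h x \<bullet> b) *\<^sub>R deriv_at f (g x) b)"
      by (intro smooth_on_bilinear[OF assms(1) bounded_bilinear_scaleR]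
          smooth_on_linear_compose[OF assms(1) bounded_linear_inner_left assms(6)]
          smooth_on_compose[OF assms(1,2,4) smooth_on_deriv[OF assms(3)] assms(5)])
  qed
  show "(\<Sum>b\<in>Basis. (h x \<bullet> b) *\<^sub>R deriv_at f (g x) b) = deriv_at f (g x) (h x)" if "x \<in> U" for x
    using deriv_at_basis_expansion[OF smooth_on_differentiable[OF assms(3)], of "g x" "h x"] assms(5) that
    by auto
qed

text \<open>Product rule for \<open>z \<mapsto> Df(z) h(z)\<close>. The second derivative of \<open>f\<close> is expressed as the derivative of
\<open>z \<mapsto> Df(z) w\<close> for the constant direction \<open>w = h(x)\<close>.\<close>

lemma has_derivative_deriv_apply:
  assumes "open U" "smooth_on U f" "x \<in> U" "(h has_derivative h') (at x)"
  shows "((\<lambda>z. deriv_at f z (h z)) has_derivative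
    (\<lambda>u. deriv_at (\<lambda>z. deriv_at f z (h x)) x u + deriv_at f x (h' u))) (at x)"
proof -
  have d: "((\<lambda>z. deriv_at f z v) has_derivative deriv_at (\<lambda>z. deriv_at f z v) x) (at x)" for v
    using has_deriv_at smooth_on_differentiable smooth_on_deriv assms by blast
  have e: "deriv_at f z v = (\<Sum>b\<in>Basis. (v \<bullet> b) *\<^sub>R deriv_at f z b)" if "z \<in> U" for z v
    using deriv_at_basis_expansion smooth_on_differentiable assms(2) that by blast
  have "((\<lambda>z. \<Sum>b\<in>Basis. (h z \<bullet> b) *\<^sub>R deriv_at f z b) has_derivative
      (\<lambda>u. \<Sum>b\<in>Basis. (h x \<bullet> b) *\<^sub>R deriv_at (\<lambda>z. deriv_at f z b) x u + (h' u \<bullet> b) *\<^sub>R deriv_at f x b)) (at x)"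
    by (rule has_derivative_sum) (rule has_derivative_scaleR[OF has_derivative_inner_left[OF assms(4)] d])
  moreover have "deriv_at (\<lambda>z. deriv_at f z (h x)) x u = (\<Sum>b\<in>Basis. (h x \<bullet> b) *\<^sub>R deriv_at (\<lambda>z. deriv_at f z b) x u)" for u
  proof -
    have "((\<lambda>z. \<Sum>b\<in>Basis. (h x \<bullet> b) *\<^sub>R deriv_at f z b) has_derivative
      (\<lambda>u. \<Sum>b\<in>Basis. (h x \<bullet> b) *\<^sub>R deriv_at (\<lambda>z. deriv_at f z b) x u)) (at x)"
      by (rule has_derivative_sum) (rule has_derivative_scaleR_right[OF d])
    then have "((\<lambda>z. deriv_at f z (h x)) has_derivative
      (\<lambda>u. \<Sum>b\<in>Basis. (h x \<bullet> b) *\<^sub>R deriv_at (\<lambda>z. deriv_at f z b) x u)) (at x)"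
      by (rule has_derivative_transform_within_open[OF _ assms(1,3)]) (rule e[symmetric])
    then show ?thesis by (simp add: deriv_at_eqI)
  qed
  ultimately have "((\<lambda>z. \<Sum>b\<in>Basis. (h z \<bullet> b) *\<^sub>R deriv_at f z b) has_derivative
      (\<lambda>u. deriv_at (\<lambda>z. deriv_at f z (h x)) x u + deriv_at f x (h' u))) (at x)"
    by (simp only: sum.distrib e[OF assms(3), of "h' _"])
  then show ?thesis
    by (rule has_derivative_transform_within_open[OF _ assms(1,3)]) (rule e[symmetric])
qed

lemma deriv_at_deriv_apply:
  assumes "open U" "smooth_on U f" "x \<in> U" "h differentiable (at x)"
  shows "deriv_at (\<lambda>z. deriv_at f z (h z)) x u
    = deriv_at (\<lambda>z. deriv_at f z (h x)) x u + deriv_at f x (deriv_at h x u)"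
  using deriv_at_eqI[OF has_derivative_deriv_apply[OF assms(1-3) has_deriv_at[OF assms(4)]]] by simp

section \<open>Symmetry of second derivatives\<close>

text \<open>The mean value theorem is applied first in the direction \<open>u\<close> to the difference of \<open>f\<close> along \<open>v\<close>,
and then in the direction \<open>v\<close> to \<open>Df \<cdot> u\<close>. The left-hand side is symmetric in
\<open>u\<close> and \<open>v\<close>, which is what makes the formula useful.\<close>

lemma second_difference_mvt:
  fixes f :: "'a::euclidean_space \<Rightarrow> real"
  assumes "smooth_on U f" "0 < t"
    and "\<And>a b. 0 \<le> a \<Longrightarrow> a \<le> t \<Longrightarrow> 0 \<le> b \<Longrightarrow> b \<le> t \<Longrightarrow> x + a *\<^sub>R u + b *\<^sub>R v \<in> U"
  shows "\<exists>a b. 0 < a \<and> a < t \<and> 0 < b \<and> b < t \<and>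
    f (x + t *\<^sub>R u + t *\<^sub>R v) - f (x + t *\<^sub>R u) - f (x + t *\<^sub>R v) + f x
      = t * t * deriv_at (\<lambda>z. deriv_at f z u) (x + a *\<^sub>R u + b *\<^sub>R v) v"
proof -
  have d1: "((\<lambda>a. f (x + a *\<^sub>R u + b *\<^sub>R v)) has_real_derivative deriv_at f (x + a *\<^sub>R u + b *\<^sub>R v) u) (at a)"
    if "0 \<le> a" "a \<le> t" "0 \<le> b" "b \<le> t" for a b
  proof -
    have f: "(f has_derivative deriv_at f (x + a *\<^sub>R u + b *\<^sub>R v)) (at (x + a *\<^sub>R u + b *\<^sub>R v))"
      using assms(1,3) that by (blast intro: has_deriv_at smooth_on_differentiable)
    have "((\<lambda>a. x + a *\<^sub>R u + b *\<^sub>R v) has_derivative (\<lambda>s. s *\<^sub>R u)) (at a)"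
      by (auto intro!: derivative_eq_intros)
    from diff_chain_at[OF this f]
    have "((\<lambda>a. f (x + a *\<^sub>R u + b *\<^sub>R v)) has_derivative (\<lambda>s. deriv_at f (x + a *\<^sub>R u + b *\<^sub>R v) (s *\<^sub>R u))) (at a)"
      by (simp add: o_def)
    moreover have "(\<lambda>s. deriv_at f (x + a *\<^sub>R u + b *\<^sub>R v) (s *\<^sub>R u)) = (*) (deriv_at f (x + a *\<^sub>R u + b *\<^sub>R v) u)"
      using linear_cmul[OF has_derivative_linear[OF f]] by (auto simp: mult.commute)
    ultimately show ?thesis by (simp add: has_field_derivative_def)
  qed
  have d2: "((\<lambda>b. deriv_at f (x + a *\<^sub>R u + b *\<^sub>R v) u) has_real_derivative
      deriv_at (\<lambda>z. deriv_at f z u) (x + a *\<^sub>R u + b *\<^sub>R v) v) (at b)"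
    if "0 \<le> a" "a \<le> t" "0 \<le> b" "b \<le> t" for a b
  proof -
    let ?g = "\<lambda>z. deriv_at f z u"
    have f: "(?g has_derivative deriv_at ?g (x + a *\<^sub>R u + b *\<^sub>R v)) (at (x + a *\<^sub>R u + b *\<^sub>R v))"
      using assms(1,3) that by (blast intro: has_deriv_at smooth_on_differentiable smooth_on_deriv)
    have "((\<lambda>b. x + a *\<^sub>R u + b *\<^sub>R v) has_derivative (\<lambda>s. s *\<^sub>R v)) (at b)"
      by (auto intro!: derivative_eq_intros)
    from diff_chain_at[OF this f]
    have "((\<lambda>b. ?g (x + a *\<^sub>R u + b *\<^sub>R v)) has_derivative (\<lambda>s. deriv_at ?g (x + a *\<^sub>R u + b *\<^sub>R v) (s *\<^sub>R v))) (at b)"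
      by (simp add: o_def)
    moreover have "(\<lambda>s. deriv_at ?g (x + a *\<^sub>R u + b *\<^sub>R v) (s *\<^sub>R v)) = (*) (deriv_at ?g (x + a *\<^sub>R u + b *\<^sub>R v) v)"
      using linear_cmul[OF has_derivative_linear[OF f]] by (auto simp: mult.commute)
    ultimately show ?thesis by (simp add: has_field_derivative_def)
  qed
  have "((\<lambda>a. f (x + a *\<^sub>R u + t *\<^sub>R v) - f (x + a *\<^sub>R u + 0 *\<^sub>R v)) has_real_derivative
      deriv_at f (x + a *\<^sub>R u + t *\<^sub>R v) u - deriv_at f (x + a *\<^sub>R u + 0 *\<^sub>R v) u) (at a)"
    if "0 \<le> a" "a \<le> t" for a
    by (rule DERIV_diff; rule d1) (use assms(2) that in auto)
  from MVT2[OF assms(2) this] obtain a where a: "0 < a" "a < t"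
    "(f (x + t *\<^sub>R u + t *\<^sub>R v) - f (x + t *\<^sub>R u + 0 *\<^sub>R v)) - (f (x + 0 *\<^sub>R u + t *\<^sub>R v) - f (x + 0 *\<^sub>R u + 0 *\<^sub>R v))
      = (t - 0) * (deriv_at f (x + a *\<^sub>R u + t *\<^sub>R v) u - deriv_at f (x + a *\<^sub>R u + 0 *\<^sub>R v) u)"
    by blast
  from MVT2[OF assms(2) d2[of a]] obtain b where b: "0 < b" "b < t"
    "deriv_at f (x + a *\<^sub>R u + t *\<^sub>R v) u - deriv_at f (x + a *\<^sub>R u + 0 *\<^sub>R v) u
      = (t - 0) * deriv_at (\<lambda>z. deriv_at f z u) (x + a *\<^sub>R u + b *\<^sub>R v) v"
    using a(1,2) by auto
  have "f (x + t *\<^sub>R u + t *\<^sub>R v) - f (x + t *\<^sub>R u) - f (x + t *\<^sub>R v) + f x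
      = t * (t * deriv_at (\<lambda>z. deriv_at f z u) (x + a *\<^sub>R u + b *\<^sub>R v) v)"
    using a(3) unfolding b(3) by simp
  then show ?thesis
    using a(1,2) b(1,2) unfolding mult.assoc by blast
qed

lemma second_deriv_symmetric_real:
  fixes f :: "'a::euclidean_space \<Rightarrow> real"
  assumes "open U" "smooth_on U f" "x \<in> U"
  shows "deriv_at (\<lambda>z. deriv_at f z u) x v = deriv_at (\<lambda>z. deriv_at f z v) x u"
proof -
  obtain r where r: "0 < r" "ball x r \<subseteq> U" using assms openE by blast
  define N where "N = norm u + norm v + 1"
  have N: "N > 0" by (simp add: N_def add_nonneg_pos)
  have inball: "dist x (x + a *\<^sub>R u + b *\<^sub>R v) < e"
    if "0 \<le> a" "a \<le> t" "0 \<le> b" "b \<le> t" "0 < t" "t * N \<le> e" for a b t e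
  proof -
    have "dist x (x + a *\<^sub>R u + b *\<^sub>R v) = norm (a *\<^sub>R u + b *\<^sub>R v)"
      by (metis add.assoc dist_add_cancel dist_0_norm add_0_right)
    also have "\<dots> \<le> a * norm u + b * norm v" using norm_triangle_ineq[of "a *\<^sub>R u" "b *\<^sub>R v"] that by simp
    also have "\<dots> \<le> t * norm u + t * norm v" using that by (intro add_mono mult_right_mono) auto
    also have "\<dots> < t * N" using that by (simp add: N_def algebra_simps)
    finally show ?thesis using that by simp
  qed
  let ?p = "\<lambda>z. deriv_at (\<lambda>z. deriv_at f z u) z v"
  let ?q = "\<lambda>z. deriv_at (\<lambda>z. deriv_at f z v) z u"
  have cont: "isCont ?p x" "isCont ?q x"
    using assms smooth_on_continuous[OF smooth_on_deriv[OF smooth_on_deriv[OF assms(2)]]]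
    by (auto simp: continuous_on_eq_continuous_at)
  \<comment> \<open>Both orders of the mean value argument express the same second difference; as \<open>t \<rightarrow> 0\<close> the
    intermediate points tend to \<open>x\<close>, so by continuity the two derivatives agree at \<open>x\<close>.\<close>
  show ?thesis
  proof (rule ccontr)
    assume ne: "?p x \<noteq> ?q x"
    define e where "e = \<bar>?p x - ?q x\<bar> / 2"
    have e: "e > 0" using ne by (simp add: e_def)
    obtain d1 where d1: "d1 > 0" "\<And>z. dist z x < d1 \<Longrightarrow> dist (?p z) (?p x) < e"
      using cont(1) e unfolding continuous_at_eps_delta by blast
    obtain d2 where d2: "d2 > 0" "\<And>z. dist z x < d2 \<Longrightarrow> dist (?q z) (?q x) < e"
      using cont(2) e unfolding continuous_at_eps_delta by blast
    define t where "t = min r (min d1 d2) / N"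
    \<comment> \<open>With this \<open>t\<close> the whole parallelogram lies in the balls of radius \<open>r\<close>, \<open>d1\<close> and \<open>d2\<close> around \<open>x\<close>.\<close>
    have t: "t > 0" "t * N \<le> r" "t * N \<le> d1" "t * N \<le> d2" using r d1 d2 N by (auto simp: t_def)
    have U1: "x + a *\<^sub>R u + b *\<^sub>R v \<in> U" if "0 \<le> a" "a \<le> t" "0 \<le> b" "b \<le> t" for a b
      using inball[OF that t(1,2)] r(2) by auto
    have U2: "x + a *\<^sub>R v + b *\<^sub>R u \<in> U" if "0 \<le> a" "a \<le> t" "0 \<le> b" "b \<le> t" for a b
      using U1[OF that(3,4,1,2)] by (simp add: ac_simps)
    obtain a b where ab: "0 < a" "a < t" "0 < b" "b < t"
      "f (x + t *\<^sub>R u + t *\<^sub>R v) - f (x + t *\<^sub>R u) - f (x + t *\<^sub>R v) + f x = t * t * ?p (x + a *\<^sub>R u + b *\<^sub>R v)"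
      using second_difference_mvt[OF assms(2) t(1) U1] by blast
    obtain a' b' where ab': "0 < a'" "a' < t" "0 < b'" "b' < t"
      "f (x + t *\<^sub>R v + t *\<^sub>R u) - f (x + t *\<^sub>R v) - f (x + t *\<^sub>R u) + f x = t * t * ?q (x + a' *\<^sub>R v + b' *\<^sub>R u)"
      using second_difference_mvt[OF assms(2) t(1) U2] by blast
    have "t * t * ?p (x + a *\<^sub>R u + b *\<^sub>R v) = t * t * ?q (x + a' *\<^sub>R v + b' *\<^sub>R u)"
      using ab(5) ab'(5) by (simp add: algebra_simps)
    then have eq: "?p (x + a *\<^sub>R u + b *\<^sub>R v) = ?q (x + a' *\<^sub>R v + b' *\<^sub>R u)" using t(1) by simp
    have p: "dist (?p (x + a *\<^sub>R u + b *\<^sub>R v)) (?p x) < e"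
      using inball[of a t b d1] ab t by (intro d1) (simp add: dist_commute)
    have q: "dist (?q (x + a' *\<^sub>R v + b' *\<^sub>R u)) (?q x) < e"
      using inball[of b' t a' d2] ab' t by (intro d2) (simp add: dist_commute algebra_simps)
    show False using p q eq unfolding dist_real_def e_def by (simp add: abs_if split: if_splits)
  qed
qed

lemma second_deriv_symmetric:
  assumes "open U" "smooth_on U f" "x \<in> U"
  shows "deriv_at (\<lambda>z. deriv_at f z u) x v = deriv_at (\<lambda>z. deriv_at f z v) x u"
proof (rule euclidean_eqI)
  fix b :: 'b assume "b \<in> Basis"
  have s: "smooth_on U (\<lambda>z. f z \<bullet> b)"
    by (intro smooth_on_linear_compose[OF assms(1) bounded_linear_inner_left assms(2)])
  have 1: "deriv_at (\<lambda>z. g z \<bullet> b) y w = deriv_at g y w \<bullet> b" if "smooth_on U g" "y \<in> U" for g :: "'a \<Rightarrow> 'b" and y w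
    using deriv_at_eqI[OF has_derivative_inner_left[OF has_deriv_at[OF smooth_on_differentiable[OF that]], of b]] by simp
  have 2: "deriv_at (\<lambda>z. deriv_at (\<lambda>z. f z \<bullet> b) z w) x w' = deriv_at (\<lambda>z. deriv_at f z w) x w' \<bullet> b" for w w'
  proof -
    have "deriv_at (\<lambda>z. deriv_at (\<lambda>z. f z \<bullet> b) z w) x = deriv_at (\<lambda>z. deriv_at f z w \<bullet> b) x"
      by (intro deriv_at_cong[OF assms(1,3)] 1 assms(2))
    then show ?thesis using 1[OF smooth_on_deriv[OF assms(2)] assms(3)] by simp
  qed
  show "deriv_at (\<lambda>z. deriv_at f z u) x v \<bullet> b = deriv_at (\<lambda>z. deriv_at f z v) x u \<bullet> b"
    using second_deriv_symmetric_real[OF assms(1) s assms(3), of u v] by (simp add: 2)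
qed

section \<open>Functions, vector fields and forms on a manifold\<close>

text \<open>The calculus of fields and forms uses the transition maps only, not the topology of the
manifold. Stating it for a bare atlas allows it to be used for the slit tangent bundle, which is
given by its charts.\<close>

locale smooth_atlas =
  fixes A :: "('p, 'e::euclidean_space) chart set"
  assumes inj: "c \<in> A \<Longrightarrow> inj_on (chart_map c) (chart_dom c)"
    and overlap_open: "c \<in> A \<Longrightarrow> d \<in> A \<Longrightarrow> open (chart_map c ` (chart_dom c \<inter> chart_dom d))"
    and transition_smooth: "c \<in> A \<Longrightarrow> d \<in> A \<Longrightarrow>
      smooth_on (chart_map c ` (chart_dom c \<inter> chart_dom d)) (transition c d)"
begin

lemma img_open: "c \<in> A \<Longrightarrow> open (chart_img c)"
  using overlap_open[of c c] by (simp add: chart_img_def)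

lemma chart_inv_map: "c \<in> A \<Longrightarrow> p \<in> chart_dom c \<Longrightarrow> chart_inv c (chart_map c p) = p"
  unfolding chart_inv_def using inj by (simp add: inv_into_f_f)

lemma chart_map_inv: "x \<in> chart_img c \<Longrightarrow> chart_map c (chart_inv c x) = x"
  unfolding chart_inv_def chart_img_def by (rule f_inv_into_f)

lemma chart_inv_dom: "x \<in> chart_img c \<Longrightarrow> chart_inv c x \<in> chart_dom c"
  unfolding chart_inv_def chart_img_def by (rule inv_into_into)

lemma charts_atD: "c \<in> charts_at A p \<Longrightarrow> c \<in> A" "c \<in> charts_at A p \<Longrightarrow> p \<in> chart_dom c"
  by (auto simp: charts_at_def)

lemma charts_at_inv: "c \<in> A \<Longrightarrow> x \<in> chart_img c \<Longrightarrow> c \<in> charts_at A (chart_inv c x)"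
  by (simp add: charts_at_def chart_inv_dom)

lemma charts_at_img: "c \<in> charts_at A p \<Longrightarrow> chart_map c p \<in> chart_img c"
  by (auto simp: charts_at_def chart_img_def)

lemma charts_at_inv_map: "c \<in> charts_at A p \<Longrightarrow> chart_inv c (chart_map c p) = p"
  by (auto simp: charts_at_def chart_inv_map)

lemma charts_at_points: "c \<in> charts_at A p \<Longrightarrow> p \<in> points A"
  by (auto simp: charts_at_def points_def)

lemma some_chart_at: "p \<in> points A \<Longrightarrow> some_chart A p \<in> charts_at A p"
  unfolding some_chart_def by (rule someI_ex) (auto simp: charts_at_def points_def)

lemma overlap_img: "chart_map c ` (chart_dom c \<inter> chart_dom d) \<subseteq> chart_img c"
  by (auto simp: chart_img_def)

lemma overlap_point:
  assumes "c \<in> A" "d \<in> A" "x \<in> chart_map c ` (chart_dom c \<inter> chart_dom d)"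
  shows "c \<in> charts_at A (chart_inv c x)" "d \<in> charts_at A (chart_inv c x)"
    "transition c d x \<in> chart_img d" "chart_inv d (transition c d x) = chart_inv c x"
  using assms by (auto simp: charts_at_def chart_inv_map transition_def chart_img_def)

lemma overlapI: "c \<in> charts_at A p \<Longrightarrow> d \<in> charts_at A p \<Longrightarrow>
    chart_map c p \<in> chart_map c ` (chart_dom c \<inter> chart_dom d)"
  by (auto simp: charts_at_def)

lemma transition_map: "c \<in> charts_at A p \<Longrightarrow> transition c d (chart_map c p) = chart_map d p"
  by (simp add: transition_def charts_at_inv_map)

lemma transition_differentiable:
  "c \<in> charts_at A p \<Longrightarrow> d \<in> charts_at A p \<Longrightarrow> transition c d differentiable (at (chart_map c p))"
  by (rule smooth_on_differentiable[OF transition_smooth overlapI]) (auto simp: charts_at_def)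

lemma transition_deriv_linear:
  "c \<in> charts_at A p \<Longrightarrow> d \<in> charts_at A p \<Longrightarrow> linear (deriv_at (transition c d) (chart_map c p))"
  using transition_differentiable linear_frechet_derivative by blast

subsection \<open>Smooth functions\<close>

abbreviation "SF \<equiv> smooth_functions A"
abbreviation "VF \<equiv> vector_fields A"
abbreviation "br \<equiv> lie_bracket A"
abbreviation "app \<equiv> vf_apply A"

abbreviation frep :: "('p \<Rightarrow> real) \<Rightarrow> ('p, 'e) chart \<Rightarrow> 'e \<Rightarrow> real" where
  "frep f c \<equiv> (\<lambda>x. f (chart_inv c x))"

abbreviation rep :: "('p, 'e) vfield \<Rightarrow> ('p, 'e) chart \<Rightarrow> 'e \<Rightarrow> 'e" where
  "rep X c \<equiv> (\<lambda>x. X (chart_inv c x) c)"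

lemma SF_smooth: "f \<in> SF \<Longrightarrow> c \<in> A \<Longrightarrow> smooth_on (chart_img c) (frep f c)"
  by (simp add: smooth_functions_def)

lemma SF_differentiable: "f \<in> SF \<Longrightarrow> c \<in> A \<Longrightarrow> x \<in> chart_img c \<Longrightarrow> frep f c differentiable (at x)"
  using SF_smooth smooth_on_differentiable by blast

lemma VF_smooth: "X \<in> VF \<Longrightarrow> c \<in> A \<Longrightarrow> smooth_on (chart_img c) (rep X c)"
  by (simp add: vector_fields_def)

lemma VF_differentiable: "X \<in> VF \<Longrightarrow> c \<in> A \<Longrightarrow> x \<in> chart_img c \<Longrightarrow> rep X c differentiable (at x)"
  using VF_smooth smooth_on_differentiable by blast

lemma VF_zero_index: "X \<in> VF \<Longrightarrow> c \<notin> charts_at A p \<Longrightarrow> X p c = 0"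
  unfolding vector_fields_def tangent_space_def by blast

lemma VF_outside: "X \<in> VF \<Longrightarrow> p \<notin> points A \<Longrightarrow> X p = 0"
  using VF_zero_index charts_at_points by (fastforce simp: fun_eq_iff)

lemma VF_change: "X \<in> VF \<Longrightarrow> c \<in> charts_at A p \<Longrightarrow> d \<in> charts_at A p \<Longrightarrow>
    X p d = deriv_at (transition c d) (chart_map c p) (X p c)"
  unfolding vector_fields_def tangent_space_def by blast

lemma VF_I:
  assumes "\<And>p c. c \<notin> charts_at A p \<Longrightarrow> X p c = 0"
    and "\<And>p c d. c \<in> charts_at A p \<Longrightarrow> d \<in> charts_at A p \<Longrightarrow>
      X p d = deriv_at (transition c d) (chart_map c p) (X p c)"
    and "\<And>c. c \<in> A \<Longrightarrow> smooth_on (chart_img c) (rep X c)"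
  shows "X \<in> VF"
  using assms unfolding vector_fields_def tangent_space_def by blast

lemma VF_eqI:
  assumes "X \<in> VF" "Y \<in> VF" "\<And>p c. c \<in> charts_at A p \<Longrightarrow> X p c = Y p c"
  shows "X = Y"
proof (intro ext)
  fix p c show "X p c = Y p c"
    using assms VF_zero_index by metis
qed

lemma deriv_change_chart:
  assumes "f \<in> SF" "c \<in> charts_at A p" "d \<in> charts_at A p"
  shows "deriv_at (frep f c) (chart_map c p) v
    = deriv_at (frep f d) (chart_map d p) (deriv_at (transition c d) (chart_map c p) v)"
proof -
  have A: "c \<in> A" "d \<in> A" using assms charts_atD by auto
  let ?O = "chart_map c ` (chart_dom c \<inter> chart_dom d)"
  have "((\<lambda>x. frep f d (transition c d x)) has_derivative
      (\<lambda>v. deriv_at (frep f d) (transition c d (chart_map c p)) (deriv_at (transition c d) (chart_map c p) v)))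
      (at (chart_map c p))"
    using diff_chain_at[OF has_deriv_at[OF transition_differentiable[OF assms(2,3)]],
        of "frep f d" "deriv_at (frep f d) (transition c d (chart_map c p))"]
      SF_differentiable[OF assms(1) A(2)] charts_at_img[OF assms(3)] transition_map[OF assms(2)]
    by (simp add: has_deriv_at o_def)
  moreover have "frep f c x = frep f d (transition c d x)" if "x \<in> ?O" for x
    using overlap_point[OF A that] by simp
  ultimately show ?thesis
    using deriv_at_cong[OF overlap_open[OF A] overlapI[OF assms(2,3)], of "frep f c" "\<lambda>x. frep f d (transition c d x)"]
    by (simp add: deriv_at_eqI transition_map[OF assms(2)])
qed

text \<open>The derivative along a field is defined through an arbitrarily chosen chart; by the chain rule
(\<open>deriv_change_chart\<close>) any chart around the point gives the same value.\<close>

lemma app_chart: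
  assumes "X \<in> VF" "f \<in> SF" "c \<in> charts_at A p"
  shows "app X f p = deriv_at (frep f c) (chart_map c p) (X p c)"
proof -
  have p: "p \<in> points A" using assms charts_at_points by blast
  show ?thesis
    using p deriv_change_chart[OF assms(2,3) some_chart_at[OF p]] VF_change[OF assms(1,3) some_chart_at[OF p]]
    by (simp add: vf_apply_def Let_def o_def)
qed

lemma app_outside: "p \<notin> points A \<Longrightarrow> app X f p = 0"
  by (simp add: vf_apply_def)

lemma frep_app:
  assumes "X \<in> VF" "f \<in> SF" "c \<in> A" "x \<in> chart_img c"
  shows "app X f (chart_inv c x) = deriv_at (frep f c) x (X (chart_inv c x) c)"
  using app_chart[OF assms(1,2) charts_at_inv[OF assms(3,4)]] chart_map_inv[OF assms(4)] by simp

lemma app_SF: "X \<in> VF \<Longrightarrow> f \<in> SF \<Longrightarrow> app X f \<in> SF"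
proof -
  assume *: "X \<in> VF" "f \<in> SF"
  have "smooth_on (chart_img c) (frep (app X f) c)" if "c \<in> A" for c
  proof (rule smooth_on_transform[OF _ img_open[OF that]])
    show "smooth_on (chart_img c) (\<lambda>x. deriv_at (frep f c) x (rep X c x))"
      by (rule smooth_on_deriv_apply[OF img_open[OF that] img_open[OF that] SF_smooth[OF *(2) that] smooth_on_id _ VF_smooth[OF *(1) that]]) simp
  qed (simp add: frep_app[OF * that])
  then show ?thesis by (simp add: smooth_functions_def app_outside)
qed

lemma SF_diff: "f \<in> SF \<Longrightarrow> g \<in> SF \<Longrightarrow> f - g \<in> SF"
  by (auto simp: smooth_functions_def intro: smooth_on_diff[OF img_open])

lemma SF_cmult: "f \<in> SF \<Longrightarrow> (\<lambda>p. r * f p) \<in> SF"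
  by (auto simp: smooth_functions_def intro: smooth_on_linear_compose[OF img_open bounded_linear_mult_right])

text \<open>Functions are extended by \<open>0\<close> outside the manifold, so this, and not \<open>\<lambda>_. r\<close>, is the constant
function on the manifold.\<close>

definition const_fun :: "real \<Rightarrow> 'p \<Rightarrow> real" where
  "const_fun r = (\<lambda>p. if p \<in> points A then r else 0)"

lemma const_fun_SF: "const_fun r \<in> SF"
proof -
  have "smooth_on (chart_img c) (frep (const_fun r) c)" if "c \<in> A" for c
  proof (rule smooth_on_transform[OF smooth_on_const[of _ r] img_open[OF that]])
    show "r = frep (const_fun r) c x" if "x \<in> chart_img c" for x
      using charts_at_points[OF charts_at_inv[OF \<open>c \<in> A\<close> that]] by (simp add: const_fun_def)
  qed
  then show ?thesis by (simp add: smooth_functions_def const_fun_def)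
qed

subsection \<open>Vector fields\<close>

lemma VF_add: "X \<in> VF \<Longrightarrow> Y \<in> VF \<Longrightarrow> X + Y \<in> VF"
  by (rule VF_I)
    (auto simp: VF_zero_index linear_add[OF transition_deriv_linear] VF_change[symmetric]
      intro: smooth_on_add[OF img_open] VF_smooth)

lemma VF_diff: "X \<in> VF \<Longrightarrow> Y \<in> VF \<Longrightarrow> X - Y \<in> VF"
  by (rule VF_I)
    (auto simp: VF_zero_index linear_diff[OF transition_deriv_linear] VF_change[symmetric]
      intro: smooth_on_diff[OF img_open] VF_smooth)

lemma VF_zero: "0 \<in> VF"
  by (rule VF_I) (auto simp: linear_0[OF transition_deriv_linear] intro: smooth_on_const)

lemma VF_uminus: "X \<in> VF \<Longrightarrow> - X \<in> VF"
  using VF_diff[OF VF_zero, of X] by simp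

lemma VF_scale: "f \<in> SF \<Longrightarrow> X \<in> VF \<Longrightarrow> vf_scale f X \<in> VF"
  by (rule VF_I)
    (auto simp: vf_scale_def VF_zero_index linear_cmul[OF transition_deriv_linear] VF_change[symmetric]
      intro: smooth_on_bilinear[OF img_open bounded_bilinear_scaleR] VF_smooth SF_smooth)

abbreviation rscale :: "real \<Rightarrow> ('p, 'e) vfield \<Rightarrow> ('p, 'e) vfield" where
  "rscale r \<equiv> vf_scale (\<lambda>_. r)"

lemma rscale_const_fun: "X \<in> VF \<Longrightarrow> rscale r X = vf_scale (const_fun r) X"
  by (auto simp: vf_scale_def const_fun_def fun_eq_iff VF_outside)

lemma VF_rscale: "X \<in> VF \<Longrightarrow> rscale r X \<in> VF"
  by (simp add: rscale_const_fun VF_scale const_fun_SF)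

lemma rscale_half: "rscale (1/2) X + rscale (1/2) X = X"
  by (intro ext) (simp add: vf_scale_def flip: scaleR_left.add)

lemma bracket_chart:
  "c \<in> charts_at A p \<Longrightarrow> br X Y p c =
    deriv_at (rep Y c) (chart_map c p) (X p c) - deriv_at (rep X c) (chart_map c p) (Y p c)"
  by (simp add: lie_bracket_def)

lemma rep_bracket:
  assumes "c \<in> A" "x \<in> chart_img c"
  shows "rep (br X Y) c x = deriv_at (rep Y c) x (rep X c x) - deriv_at (rep X c) x (rep Y c x)"
  using bracket_chart[OF charts_at_inv[OF assms]] chart_map_inv[OF assms(2)] by simp

text \<open>This differentiates the transformation law \<open>Y\<^sup>d(\<tau> z) = D\<tau>(z) Y\<^sup>c(z)\<close> of the components of \<open>Y\<close>. The
second derivative of \<open>\<tau>\<close> is the obstruction to \<open>DY \<cdot> u\<close> being a tangent vector.\<close>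

lemma deriv_VF_change:
  assumes "Y \<in> VF" "c \<in> charts_at A p" "d \<in> charts_at A p"
  defines "\<tau> \<equiv> transition c d" and "x \<equiv> chart_map c p"
  shows "deriv_at (rep Y d) (chart_map d p) (deriv_at \<tau> x u)
    = deriv_at (\<lambda>z. deriv_at \<tau> z (Y p c)) x u + deriv_at \<tau> x (deriv_at (rep Y c) x u)"
proof -
  have A: "c \<in> A" "d \<in> A" using assms charts_atD by auto
  let ?O = "chart_map c ` (chart_dom c \<inter> chart_dom d)"
  have x: "x \<in> ?O" "x \<in> chart_img c" using overlapI[OF assms(2,3)] charts_at_img[OF assms(2)] by (auto simp: x_def)
  have 1: "((\<lambda>z. rep Y d (\<tau> z)) has_derivative (\<lambda>v. deriv_at (rep Y d) (\<tau> x) (deriv_at \<tau> x v))) (at x)"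
    using diff_chain_at[OF has_deriv_at[OF transition_differentiable[OF assms(2,3)]],
        of "rep Y d" "deriv_at (rep Y d) (transition c d (chart_map c p))"]
      VF_differentiable[OF assms(1) A(2)] charts_at_img[OF assms(3)] transition_map[OF assms(2)]
    by (simp add: has_deriv_at o_def x_def \<tau>_def)
  have 2: "rep Y d (\<tau> z) = deriv_at \<tau> z (rep Y c z)" if "z \<in> ?O" for z
    using VF_change[OF assms(1) overlap_point(1,2)[OF A that]] overlap_point[OF A that] that
      chart_map_inv overlap_img unfolding \<tau>_def by (metis subsetD)
  have "deriv_at (\<lambda>z. deriv_at \<tau> z (rep Y c z)) x u = deriv_at (rep Y d) (\<tau> x) (deriv_at \<tau> x u)"
    using deriv_at_cong[OF overlap_open[OF A] x(1) 2] deriv_at_eqI[OF 1] by simp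
  moreover have "deriv_at (\<lambda>z. deriv_at \<tau> z (rep Y c z)) x u
      = deriv_at (\<lambda>z. deriv_at \<tau> z (rep Y c x)) x u + deriv_at \<tau> x (deriv_at (rep Y c) x u)"
    using deriv_at_deriv_apply[OF overlap_open[OF A] _ x(1) VF_differentiable[OF assms(1) A(1) x(2)], of \<tau>]
      transition_smooth[OF A] by (simp add: \<tau>_def)
  ultimately show ?thesis
    using transition_map[OF assms(2)] charts_at_inv_map[OF assms(2)] by (simp add: \<tau>_def x_def)
qed

text \<open>The terms with the second derivative of the transition map are symmetric in \<open>X\<close> and \<open>Y\<close> and cancel
in the bracket.\<close>

lemma bracket_VF: "X \<in> VF \<Longrightarrow> Y \<in> VF \<Longrightarrow> br X Y \<in> VF"
proof (rule VF_I)
  assume XY: "X \<in> VF" "Y \<in> VF"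
  show "br X Y p c = 0" if "c \<notin> charts_at A p" for p c
    using that by (simp add: lie_bracket_def)
  show "br X Y p d = deriv_at (transition c d) (chart_map c p) (br X Y p c)"
    if cd: "c \<in> charts_at A p" "d \<in> charts_at A p" for p c d
  proof -
    have "deriv_at (\<lambda>z. deriv_at (transition c d) z (Y p c)) (chart_map c p) (X p c)
      = deriv_at (\<lambda>z. deriv_at (transition c d) z (X p c)) (chart_map c p) (Y p c)"
      using cd charts_atD by (intro second_deriv_symmetric[OF overlap_open transition_smooth overlapI[OF cd]]) auto
    then show ?thesis
      using deriv_VF_change[OF XY(2) cd, of "X p c"] deriv_VF_change[OF XY(1) cd, of "Y p c"]
      by (simp add: bracket_chart[OF cd(1)] bracket_chart[OF cd(2)] linear_diff[OF transition_deriv_linear[OF cd]]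
          VF_change[OF XY(1) cd] VF_change[OF XY(2) cd])
  qed
  show "smooth_on (chart_img c) (rep (br X Y) c)" if "c \<in> A" for c
  proof (rule smooth_on_transform[OF _ img_open[OF that]])
    show "smooth_on (chart_img c) (\<lambda>x. deriv_at (rep Y c) x (rep X c x) - deriv_at (rep X c) x (rep Y c x))"
      using XY that
      by (intro smooth_on_diff smooth_on_deriv_apply[of _ "chart_img c"] img_open VF_smooth smooth_on_id) auto
  qed (simp add: rep_bracket[OF that])
qed

lemma deriv_rep_bracket:
  assumes "X \<in> VF" "Y \<in> VF" "c \<in> A" "x \<in> chart_img c"
  shows "deriv_at (rep (br X Y) c) x u =
     deriv_at (\<lambda>z. deriv_at (rep Y c) z (rep X c x)) x u + deriv_at (rep Y c) x (deriv_at (rep X c) x u)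
   - (deriv_at (\<lambda>z. deriv_at (rep X c) z (rep Y c x)) x u + deriv_at (rep X c) x (deriv_at (rep Y c) x u))"
proof -
  note d = has_derivative_deriv_apply[OF img_open[OF assms(3)] VF_smooth[OF _ assms(3)] assms(4)
      has_deriv_at[OF VF_differentiable[OF _ assms(3,4)]]]
  have "((\<lambda>z. deriv_at (rep Y c) z (rep X c z) - deriv_at (rep X c) z (rep Y c z)) has_derivative
    (\<lambda>u. deriv_at (\<lambda>z. deriv_at (rep Y c) z (rep X c x)) x u + deriv_at (rep Y c) x (deriv_at (rep X c) x u)
   - (deriv_at (\<lambda>z. deriv_at (rep X c) z (rep Y c x)) x u + deriv_at (rep X c) x (deriv_at (rep Y c) x u)))) (at x)"
    by (rule has_derivative_diff[OF d d]) (use assms in auto)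
  then show ?thesis
    using deriv_at_cong[OF img_open[OF assms(3)] assms(4) rep_bracket[OF assms(3), of _ X Y]]
    by (simp add: deriv_at_eqI)
qed

text \<open>In a chart, after expansion of the three double brackets, the terms with two first derivatives
cancel pairwise, and those with a second derivative cancel by its symmetry.\<close>

lemma jacobi:
  assumes "S \<in> VF" "X \<in> VF" "Y \<in> VF"
  shows "br S (br X Y) = br (br S X) Y + br X (br S Y)"
proof (rule VF_eqI)
  show "br S (br X Y) \<in> VF" "br (br S X) Y + br X (br S Y) \<in> VF"
    using assms by (auto intro: bracket_VF VF_add)
  fix p c assume c: "c \<in> charts_at A p"
  define x where "x = chart_map c p"
  have A: "c \<in> A" and x: "x \<in> chart_img c" and p: "p = chart_inv c x"
    using charts_atD[OF c] charts_at_img[OF c] charts_at_inv_map[OF c] by (auto simp: x_def)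
  have lin: "linear (deriv_at (rep Z c) x)" if "Z \<in> VF" for Z
    using linear_frechet_derivative VF_differentiable[OF that A x] by blast
  have sym: "deriv_at (\<lambda>z. deriv_at (rep Z c) z u) x v = deriv_at (\<lambda>z. deriv_at (rep Z c) z v) x u"
    if "Z \<in> VF" for Z u v
    by (rule second_deriv_symmetric[OF img_open[OF A] VF_smooth[OF that A] x])
  show "br S (br X Y) p c = (br (br S X) Y + br X (br S Y)) p c"
    unfolding p
    by (simp add: rep_bracket[OF A x] deriv_rep_bracket[OF _ _ A x] assms linear_diff[OF lin]
        sym[OF assms(1), of "rep X c x" "rep Y c x"] sym[OF assms(2), of "rep S c x" "rep Y c x"]
        sym[OF assms(3), of "rep S c x" "rep X c x"])
qed

lemma app_bracket:
  assumes "X \<in> VF" "Y \<in> VF" "f \<in> SF"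
  shows "app (br X Y) f = app X (app Y f) - app Y (app X f)"
proof
  fix p
  show "app (br X Y) f p = (app X (app Y f) - app Y (app X f)) p"
  proof (cases "p \<in> points A")
    case True
    define c where "c = some_chart A p"
    define x where "x = chart_map c p"
    have c: "c \<in> charts_at A p" using some_chart_at True by (simp add: c_def)
    have A: "c \<in> A" and x: "x \<in> chart_img c" and p: "p = chart_inv c x"
      using charts_atD[OF c] charts_at_img[OF c] charts_at_inv_map[OF c] by (auto simp: x_def)
    have *: "deriv_at (frep (app Z f) c) x u
        = deriv_at (\<lambda>z. deriv_at (frep f c) z (rep Z c x)) x u + deriv_at (frep f c) x (deriv_at (rep Z c) x u)"
      if "Z \<in> VF" for Z u
      using deriv_at_cong[OF img_open[OF A] x frep_app[OF that assms(3) A]]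
        deriv_at_deriv_apply[OF img_open[OF A] SF_smooth[OF assms(3) A] x VF_differentiable[OF that A x]]
      by simp
    have lin: "linear (deriv_at (frep f c) x)"
      using linear_frechet_derivative SF_differentiable[OF assms(3) A x] by blast
    show ?thesis
      unfolding p
      by (simp add: frep_app[OF _ _ A x] assms bracket_VF app_SF rep_bracket[OF A x] * linear_diff[OF lin]
          second_deriv_symmetric[OF img_open[OF A] SF_smooth[OF assms(3) A] x, of "rep X c x" "rep Y c x"])
  qed (simp add: app_outside)
qed

text \<open>Linearity of the derivative along a field, read off in the chart by which it is defined.\<close>

lemma app_add_left: "X \<in> VF \<Longrightarrow> Y \<in> VF \<Longrightarrow> f \<in> SF \<Longrightarrow> app (X + Y) f = app X f + app Y f"
  and app_scale_left: "X \<in> VF \<Longrightarrow> f \<in> SF \<Longrightarrow> app (vf_scale g X) f = g * app X f"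
  and app_add_right: "X \<in> VF \<Longrightarrow> f \<in> SF \<Longrightarrow> g \<in> SF \<Longrightarrow> app X (f + g) = app X f + app X g"
  and app_diff_right: "X \<in> VF \<Longrightarrow> f \<in> SF \<Longrightarrow> g \<in> SF \<Longrightarrow> app X (f - g) = app X f - app X g"
  and app_cmult_right: "X \<in> VF \<Longrightarrow> f \<in> SF \<Longrightarrow> app X (\<lambda>p. r * f p) = (\<lambda>p. r * app X f p)"
proof -
  have lin: "linear (deriv_at (f \<circ> chart_inv (some_chart A p)) (chart_map (some_chart A p) p))"
    and hd: "(f \<circ> chart_inv (some_chart A p) has_derivative
      deriv_at (f \<circ> chart_inv (some_chart A p)) (chart_map (some_chart A p) p)) (at (chart_map (some_chart A p) p))"
    if "p \<in> points A" "f \<in> SF" for p and f :: "'p \<Rightarrow> real"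
    using SF_differentiable[OF that(2) charts_atD(1) charts_at_img, OF some_chart_at some_chart_at, OF that(1,1)]
    by (auto simp: o_def intro: linear_frechet_derivative has_deriv_at)
  show "X \<in> VF \<Longrightarrow> Y \<in> VF \<Longrightarrow> f \<in> SF \<Longrightarrow> app (X + Y) f = app X f + app Y f"
    by (auto simp: fun_eq_iff vf_apply_def Let_def linear_add[OF lin])
  show "X \<in> VF \<Longrightarrow> f \<in> SF \<Longrightarrow> app (vf_scale g X) f = g * app X f"
    by (auto simp: fun_eq_iff vf_apply_def Let_def vf_scale_def linear_cmul[OF lin])
  show "X \<in> VF \<Longrightarrow> f \<in> SF \<Longrightarrow> g \<in> SF \<Longrightarrow> app X (f + g) = app X f + app X g"
    using deriv_at_eqI[OF has_derivative_add[OF hd[of _ f] hd[of _ g]]]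
    by (auto simp: fun_eq_iff vf_apply_def Let_def o_def)
  show "X \<in> VF \<Longrightarrow> f \<in> SF \<Longrightarrow> g \<in> SF \<Longrightarrow> app X (f - g) = app X f - app X g"
    using deriv_at_eqI[OF has_derivative_diff[OF hd[of _ f] hd[of _ g]]]
    by (auto simp: fun_eq_iff vf_apply_def Let_def o_def)
  show "X \<in> VF \<Longrightarrow> f \<in> SF \<Longrightarrow> app X (\<lambda>p. r * f p) = (\<lambda>p. r * app X f p)"
    using deriv_at_eqI[OF has_derivative_mult_right[OF hd[of _ f], of _ r]]
    by (auto simp: fun_eq_iff vf_apply_def Let_def o_def)
qed

lemma app_zero_right: "app X 0 = 0"
  by (auto simp: fun_eq_iff vf_apply_def Let_def o_def)

lemma app_zero_left: "f \<in> SF \<Longrightarrow> app 0 f = 0"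
  using app_add_left[OF VF_zero VF_zero, of f] by simp

lemma bracket_swap: "br Y X = - br X Y"
  by (auto simp: fun_eq_iff lie_bracket_def)

lemma bracket_self: "br X X = 0"
  by (auto simp: fun_eq_iff lie_bracket_def)

lemma bracket_add_right:
  assumes "X \<in> VF" "Y \<in> VF" "Z \<in> VF"
  shows "br X (Y + Z) = br X Y + br X Z"
proof (rule VF_eqI)
  show "br X (Y + Z) \<in> VF" "br X Y + br X Z \<in> VF" using assms by (auto intro: bracket_VF VF_add)
  fix p c assume c: "c \<in> charts_at A p"
  note hd = has_deriv_at[OF VF_differentiable[OF _ charts_atD(1)[OF c] charts_at_img[OF c]]]
  show "br X (Y + Z) p c = (br X Y + br X Z) p c"
    using deriv_at_eqI[OF has_derivative_add[OF hd[OF assms(2)] hd[OF assms(3)]]]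
      linear_add[OF has_derivative_linear[OF hd[OF assms(1)]]]
    by (simp add: bracket_chart[OF c])
qed

lemma bracket_zero_right: "X \<in> VF \<Longrightarrow> br X 0 = 0"
  using bracket_add_right[OF _ VF_zero VF_zero, of X] by simp

subsection \<open>One-forms\<close>

lemma form_SF: "\<theta> \<in> one_forms A \<Longrightarrow> X \<in> VF \<Longrightarrow> \<theta> X \<in> SF"
  by (simp add: one_forms_def)

lemma form_add: "\<theta> \<in> one_forms A \<Longrightarrow> X \<in> VF \<Longrightarrow> Y \<in> VF \<Longrightarrow> \<theta> (X + Y) = \<theta> X + \<theta> Y"
  by (simp add: one_forms_def)

lemma form_zero: "\<theta> \<in> one_forms A \<Longrightarrow> \<theta> 0 = 0"
  using form_add[OF _ VF_zero VF_zero, of \<theta>] by simp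

lemma form_diff: "\<theta> \<in> one_forms A \<Longrightarrow> X \<in> VF \<Longrightarrow> Y \<in> VF \<Longrightarrow> \<theta> (X - Y) = \<theta> X - \<theta> Y"
  using form_add[of \<theta> "X - Y" Y] by (simp add: VF_diff)

lemma form_uminus:
  assumes "\<theta> \<in> one_forms A" "X \<in> VF"
  shows "\<theta> (- X) = - \<theta> X"
  using form_diff[OF assms(1) VF_zero assms(2)] unfolding form_zero[OF assms(1)] diff_0 .

abbreviation "d1 \<equiv> ext_d1 A"

lemma ext_d1_add_right:
  assumes "\<theta> \<in> one_forms A" "X \<in> VF" "Y \<in> VF" "Z \<in> VF"
  shows "d1 \<theta> X (Y + Z) = d1 \<theta> X Y + d1 \<theta> X Z"
  using assms
  by (simp add: ext_d1_def form_add[OF assms(1)] form_SF app_add_right app_add_left bracket_add_right bracket_VF)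

lemma ext_d1_swap:
  assumes "\<theta> \<in> one_forms A" "X \<in> VF" "Y \<in> VF"
  shows "d1 \<theta> Y X = - d1 \<theta> X Y"
  using form_uminus[OF assms(1) bracket_VF[OF assms(2,3)]]
  unfolding ext_d1_def bracket_swap[of Y X] by simp

lemma ext_d1_add_left:
  assumes "\<theta> \<in> one_forms A" "X \<in> VF" "Y \<in> VF" "Z \<in> VF"
  shows "d1 \<theta> (X + Y) Z = d1 \<theta> X Z + d1 \<theta> Y Z"
  using assms ext_d1_add_right[OF assms(1,4,2,3)] ext_d1_swap[OF assms(1,4)] by (simp add: VF_add)

lemma ext_d1_SF: "\<theta> \<in> one_forms A \<Longrightarrow> X \<in> VF \<Longrightarrow> Y \<in> VF \<Longrightarrow> d1 \<theta> X Y \<in> SF"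
  by (simp add: ext_d1_def SF_diff app_SF form_SF bracket_VF)

lemma ext_d1_zero_right: "\<theta> \<in> one_forms A \<Longrightarrow> X \<in> VF \<Longrightarrow> d1 \<theta> X 0 = 0"
  using ext_d1_add_right[OF _ _ VF_zero VF_zero, of \<theta> X] by simp

lemma ext_d1_diff_left:
  assumes "\<theta> \<in> one_forms A" "X \<in> VF" "Y \<in> VF" "Z \<in> VF"
  shows "d1 \<theta> (X - Y) Z = d1 \<theta> X Z - d1 \<theta> Y Z"
  using ext_d1_add_left[OF assms(1) VF_diff[OF assms(2,3)] assms(3,4)] by simp

lemma ext_d1_diff_right:
  assumes "\<theta> \<in> one_forms A" "X \<in> VF" "Y \<in> VF" "Z \<in> VF"
  shows "d1 \<theta> X (Y - Z) = d1 \<theta> X Y - d1 \<theta> X Z"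
  using ext_d1_add_right[OF assms(1,2) VF_diff[OF assms(3,4)] assms(4)] by simp

lemma ext_d1_zero_left: "\<theta> \<in> one_forms A \<Longrightarrow> X \<in> VF \<Longrightarrow> d1 \<theta> 0 X = 0"
  using ext_d1_add_left[OF _ VF_zero VF_zero, of \<theta> X] by simp

lemma ext_d1_cong:
  assumes "form1_eq A \<theta> \<eta>" "X \<in> VF" "Y \<in> VF"
  shows "d1 \<theta> X Y = d1 \<eta> X Y"
  using assms by (simp add: form1_eq_def ext_d1_def bracket_VF)

text \<open>This is \<open>\<L>\<^sub>S d\<theta> = d \<L>\<^sub>S \<theta> = d d L = 0\<close>, written out on pairs of fields: the commutator rule moves \<open>S\<close>
past \<open>X\<close> and \<open>Y\<close>, and the Jacobi identity disposes of the term \<open>\<theta>([S,[X,Y]])\<close>.\<close>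

lemma lie_invariant_ext_d1:
  assumes \<theta>: "\<theta> \<in> one_forms A" and L: "L \<in> SF" and S: "S \<in> VF"
    and eq: "form1_eq A (lie_form1 A S \<theta>) (ext_d0 A L)" and XY: "X \<in> VF" "Y \<in> VF"
  shows "app S (d1 \<theta> X Y) = d1 \<theta> (br S X) Y + d1 \<theta> X (br S Y)"
proof -
  have S\<theta>: "app S (\<theta> Z) = app Z L + \<theta> (br S Z)" if "Z \<in> VF" for Z
    using eq that by (auto simp: form1_eq_def lie_form1_def ext_d0_def algebra_simps)
  have comm: "app S (app Z f) = app (br S Z) f + app Z (app S f)" if "Z \<in> VF" "f \<in> SF" for Z f
    using app_bracket[OF S that] by simp
  have "app S (app X (\<theta> Y)) = app (br S X) (\<theta> Y) + app X (app Y L) + app X (\<theta> (br S Y))"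
    using XY \<theta> S L by (simp add: comm form_SF S\<theta> app_add_right app_SF bracket_VF)
  moreover have "app S (app Y (\<theta> X)) = app (br S Y) (\<theta> X) + app Y (app X L) + app Y (\<theta> (br S X))"
    using XY \<theta> S L by (simp add: comm form_SF S\<theta> app_add_right app_SF bracket_VF)
  moreover have "app S (\<theta> (br X Y)) = app X (app Y L) - app Y (app X L) + \<theta> (br (br S X) Y) + \<theta> (br X (br S Y))"
    using XY S L by (simp add: S\<theta> bracket_VF app_bracket jacobi[OF S XY] form_add[OF \<theta>])
  moreover have "app S (d1 \<theta> X Y) = app S (app X (\<theta> Y)) - app S (app Y (\<theta> X)) - app S (\<theta> (br X Y))"
    using XY S \<theta> by (simp add: ext_d1_def app_diff_right SF_diff app_SF form_SF bracket_VF)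
  ultimately show ?thesis
    by (simp add: ext_d1_def)
qed

end

section \<open>The slit tangent bundle as a manifold\<close>

context smooth_atlas
begin

lemma transition_deriv_cocycle:
  assumes "c \<in> charts_at A p" "d \<in> charts_at A p" "e \<in> charts_at A p"
  shows "deriv_at (transition c e) (chart_map c p) v
    = deriv_at (transition d e) (chart_map d p) (deriv_at (transition c d) (chart_map c p) v)"
proof -
  let ?O = "chart_map c ` (chart_dom c \<inter> chart_dom d) \<inter> chart_map c ` (chart_dom c \<inter> chart_dom e)"
  have A: "c \<in> A" "d \<in> A" "e \<in> A" using assms charts_atD by auto
  have O: "open ?O" "chart_map c p \<in> ?O"
    using overlap_open[OF A(1,2)] overlap_open[OF A(1,3)] overlapI[OF assms(1,2)] overlapI[OF assms(1,3)] by auto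
  have 1: "((\<lambda>x. transition d e (transition c d x)) has_derivative (\<lambda>v. deriv_at (transition d e) (transition c d (chart_map c p))
      (deriv_at (transition c d) (chart_map c p) v))) (at (chart_map c p))"
    using diff_chain_at[OF has_deriv_at[OF transition_differentiable[OF assms(1,2)]],
        of "transition d e" "deriv_at (transition d e) (transition c d (chart_map c p))"]
      transition_differentiable[OF assms(2,3)] transition_map[OF assms(1)]
    by (simp add: has_deriv_at o_def)
  have 2: "transition c e x = transition d e (transition c d x)" if "x \<in> ?O" for x
    using overlap_point[OF A(1,2), of x] that by (simp add: transition_def)
  show ?thesis
    using deriv_at_cong[OF O 2] deriv_at_eqI[OF 1] transition_map[OF assms(1)] by simp
qed

lemma transition_deriv_self:
  assumes "c \<in> charts_at A p"
  shows "deriv_at (transition c c) (chart_map c p) v = v"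
proof -
  have "deriv_at (transition c c) (chart_map c p) = deriv_at (\<lambda>x. x) (chart_map c p)"
    by (rule deriv_at_cong[OF img_open[OF charts_atD(1)[OF assms]] charts_at_img[OF assms]])
      (simp add: transition_def chart_map_inv)
  then show ?thesis by simp
qed

lemma tangent_space_change: "\<xi> \<in> tangent_space A p \<Longrightarrow> c \<in> charts_at A p \<Longrightarrow> d \<in> charts_at A p \<Longrightarrow>
    \<xi> d = deriv_at (transition c d) (chart_map c p) (\<xi> c)"
  unfolding tangent_space_def by blast

lemma tangent_space_zero_index: "\<xi> \<in> tangent_space A p \<Longrightarrow> c \<notin> charts_at A p \<Longrightarrow> \<xi> c = 0"
  unfolding tangent_space_def by blast

lemma tangent_space_eqI:
  assumes "\<xi> \<in> tangent_space A p" "\<eta> \<in> tangent_space A p" "c \<in> charts_at A p" "\<xi> c = \<eta> c"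
  shows "\<xi> = \<eta>"
proof
  fix d show "\<xi> d = \<eta> d"
  proof (cases "d \<in> charts_at A p")
    case True
    show ?thesis
      unfolding tangent_space_change[OF assms(1,3) True] tangent_space_change[OF assms(2,3) True] assms(4) ..
  next
    case False
    then show ?thesis
      using tangent_space_zero_index[OF assms(1)] tangent_space_zero_index[OF assms(2)] by metis
  qed
qed

lemma zero_tangent_space: "0 \<in> tangent_space A p"
  unfolding tangent_space_def using linear_0[OF transition_deriv_linear] by simp

text \<open>The unique tangent vector at \<open>p\<close> whose component in the chart \<open>c\<close> is \<open>y\<close>.\<close>

definition tvec_of :: "('p, 'e) chart \<Rightarrow> 'p \<Rightarrow> 'e \<Rightarrow> ('p, 'e) tvec" where
  "tvec_of c p y = (\<lambda>d. if d \<in> charts_at A p then deriv_at (transition c d) (chart_map c p) y else 0)"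

lemma tvec_of_tangent_space: "c \<in> charts_at A p \<Longrightarrow> tvec_of c p y \<in> tangent_space A p"
  unfolding tangent_space_def tvec_of_def
  by (intro CollectI conjI allI ballI impI) (simp_all, rule transition_deriv_cocycle)

lemma tvec_of_component: "c \<in> charts_at A p \<Longrightarrow> tvec_of c p y c = y"
  by (simp add: tvec_of_def transition_deriv_self)

end

lemma smooth_manifold_imp_smooth_atlas:
  assumes "smooth_manifold M A"
  shows "smooth_atlas A"
proof -
  interpret smooth_manifold M A by fact
  have top: "topspace (subtopology M (chart_dom c)) = chart_dom c" if "c \<in> A" for c
    using openin_subset[OF dom_open[OF that]] by auto
  show ?thesis
  proof
    show "inj_on (chart_map c) (chart_dom c)" if "c \<in> A" for c
      using homeomorphic_imp_injective_map[OF homeo[OF that]] top[OF that] by simp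
    show "open (chart_map c ` (chart_dom c \<inter> chart_dom d))" if "c \<in> A" "d \<in> A" for c d
    proof -
      have "openin (subtopology M (chart_dom c)) (chart_dom c \<inter> chart_dom d)"
        using dom_open[OF that(2)] by (auto simp: openin_subtopology)
      then have "openin (top_of_set (chart_img c)) (chart_map c ` (chart_dom c \<inter> chart_dom d))"
        using homeomorphic_imp_open_map[OF homeo[OF that(1)]] unfolding open_map_def by blast
      then show ?thesis using img_open[OF that(1)] openin_open_trans by blast
    qed
  qed (fact compatible)
qed

context smooth_atlas
begin

lemma slit_dom: "u \<in> chart_dom (slit_chart A c) \<longleftrightarrow> fst u \<in> chart_dom c \<and> snd u \<in> tangent_space A (fst u) \<and> snd u \<noteq> 0"
  by (auto simp: slit_chart_def case_prod_unfold)

lemma slit_map: "chart_map (slit_chart A c) u = (chart_map c (fst u), snd u c)"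
  by (simp add: slit_chart_def case_prod_unfold)

lemma slit_inj:
  assumes "c \<in> A"
  shows "inj_on (chart_map (slit_chart A c)) (chart_dom (slit_chart A c))"
proof (rule inj_onI)
  fix u w assume uw: "u \<in> chart_dom (slit_chart A c)" "w \<in> chart_dom (slit_chart A c)"
    "chart_map (slit_chart A c) u = chart_map (slit_chart A c) w"
  then have p: "fst u = fst w" using inj[OF assms] by (auto simp: slit_dom slit_map inj_on_def)
  moreover have "snd u = snd w"
    using uw p assms by (intro tangent_space_eqI[of "snd u" "fst u" "snd w" c]) (auto simp: slit_dom slit_map charts_at_def)
  ultimately show "u = w" by (simp add: prod_eq_iff)
qed

lemma tangent_nonzero:
  assumes "\<xi> \<in> tangent_space A p" "\<xi> \<noteq> 0" "c \<in> charts_at A p"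
  shows "\<xi> c \<noteq> 0"
  using assms tangent_space_eqI[OF assms(1) zero_tangent_space assms(3)] by auto

lemma slit_overlap:
  assumes "c \<in> A" "d \<in> A"
  shows "chart_map (slit_chart A c) ` (chart_dom (slit_chart A c) \<inter> chart_dom (slit_chart A d))
    = (chart_map c ` (chart_dom c \<inter> chart_dom d)) \<times> (- {0})" (is "?l = ?r")
proof
  show "?l \<subseteq> ?r"
  proof (rule image_subsetI)
    fix u assume "u \<in> chart_dom (slit_chart A c) \<inter> chart_dom (slit_chart A d)"
    then show "chart_map (slit_chart A c) u \<in> ?r"
      using tangent_nonzero[of "snd u" "fst u" c] assms(1) by (simp add: slit_dom slit_map charts_at_def)
  qed
  show "?r \<subseteq> ?l"
  proof
    fix w assume "w \<in> ?r"
    then obtain p y where p: "p \<in> chart_dom c" "p \<in> chart_dom d" "y \<noteq> 0" "w = (chart_map c p, y)" by auto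
    then have c: "c \<in> charts_at A p" using assms by (simp add: charts_at_def)
    have "(p, tvec_of c p y) \<in> chart_dom (slit_chart A c) \<inter> chart_dom (slit_chart A d)"
      using p tvec_of_tangent_space[OF c] tvec_of_component[OF c, of y] by (auto simp: slit_dom)
    moreover have "chart_map (slit_chart A c) (p, tvec_of c p y) = w"
      using p tvec_of_component[OF c] by (simp add: slit_map)
    ultimately show "w \<in> ?l" by (metis imageI)
  qed
qed

lemma slit_img: "c \<in> A \<Longrightarrow> chart_img (slit_chart A c) = chart_img c \<times> (- {0})"
  using slit_overlap[of c c] by (simp add: chart_img_def)

lemma slit_inv:
  assumes "c \<in> A" "w \<in> chart_img (slit_chart A c)"
  shows "chart_inv (slit_chart A c) w = (chart_inv c (fst w), tvec_of c (chart_inv c (fst w)) (snd w))"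
proof -
  have w: "fst w \<in> chart_img c" "snd w \<noteq> 0" using assms by (auto simp: slit_img)
  have c: "c \<in> charts_at A (chart_inv c (fst w))" by (rule charts_at_inv[OF assms(1) w(1)])
  show ?thesis
    unfolding chart_inv_def[of "slit_chart A c"]
  proof (rule inv_into_f_eq[OF slit_inj[OF assms(1)]])
    show "(chart_inv c (fst w), tvec_of c (chart_inv c (fst w)) (snd w)) \<in> chart_dom (slit_chart A c)"
      using w c tvec_of_tangent_space[OF c] tvec_of_component[OF c, of "snd w"] chart_inv_dom[OF w(1)] by (auto simp: slit_dom)
    show "chart_map (slit_chart A c) (chart_inv c (fst w), tvec_of c (chart_inv c (fst w)) (snd w)) = w"
      using w c by (simp add: slit_map tvec_of_component chart_map_inv)
  qed
qed

lemma slit_transition: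
  assumes "c \<in> A" "d \<in> A" "w \<in> (chart_map c ` (chart_dom c \<inter> chart_dom d)) \<times> (- {0})"
  shows "transition (slit_chart A c) (slit_chart A d) w = (transition c d (fst w), deriv_at (transition c d) (fst w) (snd w))"
proof -
  have x: "fst w \<in> chart_map c ` (chart_dom c \<inter> chart_dom d)" using assms(3) by auto
  have "fst w \<in> chart_img c" by (rule subsetD[OF overlap_img x])
  then have w: "w \<in> chart_img (slit_chart A c)" and "chart_map c (chart_inv c (fst w)) = fst w"
    using assms(3) by (auto simp: slit_img[OF assms(1)] chart_map_inv mem_Times_iff)
  then show ?thesis
    using overlap_point[OF assms(1,2) x]
    by (simp add: transition_def slit_inv[OF assms(1) w] slit_map tvec_of_def)
qed

text \<open>The transition maps are \<open>(x, y) \<mapsto> (\<tau> x, D\<tau>(x) y)\<close> on \<open>O \<times> (- {0})\<close>, where \<open>\<tau>\<close> is a transition map of the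
base and \<open>O\<close> its domain; the fibre part \<open>- {0}\<close> is preserved because nonzero tangent vectors have
nonzero components in every chart.\<close>

lemma smooth_atlas_slit: "smooth_atlas (slit_atlas A)"
proof
  fix C assume "C \<in> slit_atlas A"
  then obtain c where c: "c \<in> A" "C = slit_chart A c" by (auto simp: slit_atlas_def)
  show "inj_on (chart_map C) (chart_dom C)" using c slit_inj by simp
  fix D assume "D \<in> slit_atlas A"
  then obtain d where d: "d \<in> A" "D = slit_chart A d" by (auto simp: slit_atlas_def)
  let ?O = "chart_map c ` (chart_dom c \<inter> chart_dom d)"
  have o: "open ?O" "open (?O \<times> (- {0} :: 'e set))"
    using overlap_open[OF c(1) d(1)] by (auto intro: open_Times)
  show "open (chart_map C ` (chart_dom C \<inter> chart_dom D))"
    using o c d by (simp add: slit_overlap)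
  have "smooth_on (?O \<times> (- {0})) (transition C D)"
  proof (rule smooth_on_transform[OF _ o(2)])
    show "smooth_on (?O \<times> (- {0})) (\<lambda>w. (transition c d (fst w), deriv_at (transition c d) (fst w) (snd w)))"
    proof (rule smooth_on_Pair[OF o(2)])
      show "smooth_on (?O \<times> (- {0 :: 'e})) (\<lambda>w. transition c d (fst w))"
        by (rule smooth_on_compose[OF o(2,1) smooth_on_linear[OF o(2) bounded_linear_fst]
              transition_smooth[OF c(1) d(1)]]) auto
      show "smooth_on (?O \<times> (- {0})) (\<lambda>w. deriv_at (transition c d) (fst w) (snd w))"
        by (rule smooth_on_deriv_apply[OF o(2,1) transition_smooth[OF c(1) d(1)]
              smooth_on_linear[OF o(2) bounded_linear_fst] _ smooth_on_linear[OF o(2) bounded_linear_snd]]) auto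
    qed
  qed (simp add: c(2) d(2) slit_transition[OF c(1) d(1)])
  then show "smooth_on (chart_map C ` (chart_dom C \<inter> chart_dom D)) (transition C D)"
    using c d by (simp add: slit_overlap)
qed

end

locale slit_bundle = base: smooth_atlas A
  for A :: "('m, 'e::euclidean_space) chart set"
begin

sublocale smooth_atlas "slit_atlas A"
  by (rule base.smooth_atlas_slit)

abbreviation "B \<equiv> slit_atlas A"

lemma slit_charts_at_iff:
  "C \<in> charts_at B u \<longleftrightarrow> (\<exists>c\<in>charts_at A (fst u). C = slit_chart A c) \<and> snd u \<in> tangent_space A (fst u) \<and> snd u \<noteq> 0"
  unfolding charts_at_def slit_atlas_def
  by (blast dest: base.slit_dom[THEN iffD1] intro: base.slit_dom[THEN iffD2])

text \<open>The derivative of \<open>(x, y) \<mapsto> (\<tau> x, D\<tau>(x) y)\<close> is block triangular with the same diagonal blocks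
\<open>D\<tau>(x)\<close>. Since the base block and the fibre block coincide, \<open>J\<close> is independent of the
chart; the lower left block, which contains the second derivative of \<open>\<tau>\<close>, does not enter.\<close>

lemma slit_transition_at:
  assumes "slit_chart A c \<in> charts_at B u" "slit_chart A d \<in> charts_at B u"
    "c \<in> charts_at A (fst u)" "d \<in> charts_at A (fst u)"
  defines "T \<equiv> transition (slit_chart A c) (slit_chart A d)"
    and "D \<equiv> deriv_at (transition c d) (chart_map c (fst u))"
    and "w \<equiv> chart_map (slit_chart A c) u"
  shows "snd (chart_map (slit_chart A d) u) = D (snd w)"
    and "fst (deriv_at T w v) = D (fst v)"
    and "deriv_at T w (0, b) = (0, D b)"
proof -
  let ?O = "chart_map c ` (chart_dom c \<inter> chart_dom d)"
  have A: "c \<in> A" "d \<in> A" using assms(3,4) base.charts_atD by auto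
  have o: "open ?O" "open (?O \<times> (- {0} :: 'e set))"
    using base.overlap_open[OF A] by (auto intro: open_Times)
  have w: "w \<in> ?O \<times> (- {0})"
    using overlapI[OF assms(1,2)] by (simp add: w_def base.slit_overlap[OF A])
  have x: "fst w = chart_map c (fst u)" by (simp add: w_def base.slit_map)
  have T: "T z = (transition c d (fst z), deriv_at (transition c d) (fst z) (snd z))" if "z \<in> ?O \<times> (- {0})" for z
    using base.slit_transition[OF A that] by (simp add: T_def)
  have Td: "(T has_derivative deriv_at T w) (at w)"
    using transition_differentiable[OF assms(1,2)] by (simp add: T_def w_def has_deriv_at)
  have cd: "(transition c d has_derivative D) (at (fst w))"
    using base.transition_differentiable[OF assms(3,4)] by (simp add: D_def x has_deriv_at)
  show "snd (chart_map (slit_chart A d) u) = D (snd w)"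
    using T[OF w] transition_map[OF assms(1), of "slit_chart A d"] by (simp add: T_def D_def w_def base.slit_map)
  have "((\<lambda>z. fst (T z)) has_derivative (\<lambda>v. fst (deriv_at T w v))) (at w)"
    by (rule has_derivative_fst[OF Td])
  moreover have "((\<lambda>z. transition c d (fst z)) has_derivative (\<lambda>v. D (fst v))) (at w)"
    using diff_chain_at[OF has_derivative_fst[OF has_derivative_ident] cd] by (simp add: o_def)
  moreover have "deriv_at (\<lambda>z. fst (T z)) w = deriv_at (\<lambda>z. transition c d (fst z)) w"
    by (rule deriv_at_cong[OF o(2) w]) (simp add: T)
  ultimately show "fst (deriv_at T w v) = D (fst v)"
    using deriv_at_eqI by (metis (no_types, lifting))
  have inj2: "((\<lambda>y. (fst w, y)) has_derivative (\<lambda>b. (0, b))) (at (snd w))"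
    by (intro has_derivative_Pair has_derivative_const has_derivative_ident)
  have "((\<lambda>y. T (fst w, y)) has_derivative (\<lambda>b. deriv_at T w (0, b))) (at (snd w))"
    using diff_chain_at[OF inj2, of T "deriv_at T w"] Td by (simp add: o_def)
  moreover have "((\<lambda>y. (transition c d (fst w), D y)) has_derivative (\<lambda>b. (0, D b))) (at (snd w))"
    by (intro has_derivative_Pair has_derivative_const bounded_linear_imp_has_derivative has_derivative_bounded_linear[OF cd])
  moreover have "deriv_at (\<lambda>y. T (fst w, y)) (snd w) = deriv_at (\<lambda>y. (transition c d (fst w), D y)) (snd w)"
  proof (rule deriv_at_cong[of "- {0}"])
    show "T (fst w, y) = (transition c d (fst w), D y)" if "y \<in> - {0}" for y
      using T[of "(fst w, y)"] w that by (simp add: D_def x mem_Times_iff)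
  qed (use w in auto)
  ultimately show "deriv_at T w (0, b) = (0, D b)"
    using deriv_at_eqI by (metis (no_types, lifting))
qed

section \<open>The tangent structure and the Liouville field\<close>

abbreviation "J \<equiv> tangent_structure"
abbreviation "\<C> \<equiv> liouville A"

lemma J_apply: "J X u C = (0, fst (X u C))"
  by (simp add: tangent_structure_def)

lemma J_add: "J (X + Y) = J X + J Y"
  and J_diff: "J (X - Y) = J X - J Y"
  and J_uminus: "J (- X) = - J X"
  and J_zero: "J 0 = 0"
  and J_scale: "J (vf_scale f X) = vf_scale f (J X)"
  and J_J: "J (J X) = 0"
  by (auto simp: fun_eq_iff J_apply vf_scale_def zero_prod_def)

lemma VF_fst_change:
  assumes "X \<in> VF" "slit_chart A c \<in> charts_at B u" "slit_chart A d \<in> charts_at B u"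
    "c \<in> charts_at A (fst u)" "d \<in> charts_at A (fst u)"
  shows "fst (X u (slit_chart A d)) = deriv_at (transition c d) (chart_map c (fst u)) (fst (X u (slit_chart A c)))"
  using VF_change[OF assms(1-3)] slit_transition_at(2)[OF assms(2-5)] by simp

lemma J_VF:
  assumes "X \<in> VF"
  shows "J X \<in> VF"
proof (rule VF_I)
  show "J X u C = 0" if "C \<notin> charts_at B u" for u C
    using VF_zero_index[OF assms that] by (simp add: J_apply zero_prod_def)
  show "J X u D = deriv_at (transition C D) (chart_map C u) (J X u C)"
    if C: "C \<in> charts_at B u" and D: "D \<in> charts_at B u" for u C D
  proof -
    obtain c d where c: "c \<in> charts_at A (fst u)" "C = slit_chart A c" and d: "d \<in> charts_at A (fst u)" "D = slit_chart A d"
      using C D unfolding slit_charts_at_iff by blast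
    show ?thesis
      using VF_fst_change[OF assms C[unfolded c(2)] D[unfolded d(2)] c(1) d(1)]
        slit_transition_at(3)[OF C[unfolded c(2)] D[unfolded d(2)] c(1) d(1)]
      by (simp add: J_apply c(2) d(2))
  qed
  show "smooth_on (chart_img C) (rep (J X) C)" if "C \<in> B" for C
    unfolding J_apply
    by (rule smooth_on_Pair[OF img_open[OF that] smooth_on_const
        smooth_on_linear_compose[OF img_open[OF that] bounded_linear_fst VF_smooth[OF assms that]]])
qed

lemma rep_liouville: "C \<in> B \<Longrightarrow> w \<in> chart_img C \<Longrightarrow> rep \<C> C w = (0, snd w)"
  by (simp add: liouville_def charts_at_inv chart_map_inv)

lemma liouville_VF: "\<C> \<in> VF"
proof (rule VF_I)
  show "\<C> u C = 0" if "C \<notin> charts_at B u" for u C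
    using that by (simp add: liouville_def)
  show "\<C> u D = deriv_at (transition C D) (chart_map C u) (\<C> u C)"
    if C: "C \<in> charts_at B u" and D: "D \<in> charts_at B u" for u C D
  proof -
    obtain c d where c: "c \<in> charts_at A (fst u)" "C = slit_chart A c" and d: "d \<in> charts_at A (fst u)" "D = slit_chart A d"
      using C D unfolding slit_charts_at_iff by blast
    show ?thesis
      using C D slit_transition_at(1,3)[OF C[unfolded c(2)] D[unfolded d(2)] c(1) d(1)]
      by (simp add: liouville_def c(2) d(2))
  qed
  show "smooth_on (chart_img C) (rep \<C> C)" if "C \<in> B" for C
  proof (rule smooth_on_transform[OF _ img_open[OF that]])
    show "smooth_on (chart_img C) (\<lambda>w. (0, snd w))"
      by (rule smooth_on_Pair[OF img_open[OF that] smooth_on_const smooth_on_linear[OF img_open[OF that] bounded_linear_snd]])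
  qed (simp add: rep_liouville that)
qed

lemma tangent_map_fst:
  assumes "u \<in> points B" "some_chart B u = slit_chart A c" "c \<in> charts_at A (fst u)"
  shows "tangent_map B A fst u \<xi> = (\<lambda>d. if d \<in> charts_at A (fst u)
    then deriv_at (transition c d) (chart_map c (fst u)) (fst (\<xi> (slit_chart A c))) else 0)"
proof -
  have C: "slit_chart A c \<in> charts_at B u" using some_chart_at[OF assms(1)] assms(2) by simp
  have B: "slit_chart A c \<in> B" using charts_atD[OF C] by simp
  have key: "deriv_at (chart_map d \<circ> fst \<circ> chart_inv (slit_chart A c)) (chart_map (slit_chart A c) u) v
      = deriv_at (transition c d) (chart_map c (fst u)) (fst v)" if d: "d \<in> charts_at A (fst u)" for d v
  proof -
    have "deriv_at (chart_map d \<circ> fst \<circ> chart_inv (slit_chart A c)) (chart_map (slit_chart A c) u)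
      = deriv_at (\<lambda>w. transition c d (fst w)) (chart_map (slit_chart A c) u)"
      by (rule deriv_at_cong[OF img_open[OF B] charts_at_img[OF C]])
        (simp add: base.slit_inv[OF base.charts_atD(1)[OF assms(3)]] transition_def)
    moreover have "((\<lambda>z. transition c d (fst z)) has_derivative (\<lambda>v. deriv_at (transition c d) (chart_map c (fst u)) (fst v)))
        (at (chart_map (slit_chart A c) u))"
      using diff_chain_at[OF has_derivative_fst[OF has_derivative_ident], of "transition c d"
          "deriv_at (transition c d) (chart_map c (fst u))" "chart_map (slit_chart A c) u"]
        has_deriv_at[OF base.transition_differentiable[OF assms(3) d]]
      by (simp add: o_def base.slit_map)
    ultimately show ?thesis by (simp add: deriv_at_eqI)
  qed
  show ?thesis by (intro ext) (simp add: tangent_map_def assms(2) Let_def key)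
qed

text \<open>In an induced chart the projection is \<open>(x, y) \<mapsto> x\<close>, so vertical vectors are those whose first component
vanishes, and \<open>J\<close> moves exactly this component to the second place.\<close>

lemma vertical_iff: "X \<in> vertical_fields A \<longleftrightarrow> X \<in> VF \<and> J X = 0"
proof -
  have "(\<forall>u\<in>points B. tangent_map B A fst u (X u) = 0) \<longleftrightarrow> J X = 0" if X: "X \<in> VF"
  proof
    assume J: "J X = 0"
    have z: "fst (X u C) = 0" for u C
      using fun_cong[OF fun_cong[OF J, of u], of C] by (simp add: J_apply zero_prod_def)
    show "\<forall>u\<in>points B. tangent_map B A fst u (X u) = 0"
    proof
      fix u assume u: "u \<in> points B"
      obtain c where c: "c \<in> charts_at A (fst u)" "some_chart B u = slit_chart A c"
        using some_chart_at[OF u] unfolding slit_charts_at_iff by blast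
      show "tangent_map B A fst u (X u) = 0"
        using linear_0[OF base.transition_deriv_linear[OF c(1)]]
        by (auto simp: tangent_map_fst[OF u c(2,1)] z fun_eq_iff)
    qed
  next
    assume v: "\<forall>u\<in>points B. tangent_map B A fst u (X u) = 0"
    show "J X = 0"
    proof (rule VF_eqI[OF J_VF[OF X] VF_zero])
      fix u D assume D: "D \<in> charts_at B u"
      then have u: "u \<in> points B" by (rule charts_at_points)
      obtain c where c: "c \<in> charts_at A (fst u)" "some_chart B u = slit_chart A c"
        using some_chart_at[OF u] unfolding slit_charts_at_iff by blast
      obtain d where d: "d \<in> charts_at A (fst u)" "D = slit_chart A d"
        using D unfolding slit_charts_at_iff by blast
      have C: "slit_chart A c \<in> charts_at B u" using some_chart_at[OF u] c(2) by simp
      have "tangent_map B A fst u (X u) d = 0" using v u by simp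
      then have "deriv_at (transition c d) (chart_map c (fst u)) (fst (X u (slit_chart A c))) = 0"
        using d(1) by (simp add: tangent_map_fst[OF u c(2,1)])
      then show "J X u D = 0 u D"
        using VF_fst_change[OF X C D[unfolded d(2)] c(1) d(1)] by (simp add: J_apply d(2) zero_prod_def)
    qed
  qed
  then show ?thesis by (auto simp: vertical_fields_def)
qed

lemma deriv_rep_J:
  assumes "X \<in> VF" "C \<in> B" "w \<in> chart_img C"
  shows "deriv_at (rep (J X) C) w v = (0, fst (deriv_at (rep X C) w v))"
  using fun_cong[OF deriv_at_eqI[OF has_derivative_Pair[OF has_derivative_const[of 0]
      has_derivative_fst[OF has_deriv_at[OF VF_differentiable[OF assms]]]]], of v]
  unfolding J_apply by simp

lemma deriv_rep_liouville:
  assumes "C \<in> B" "w \<in> chart_img C"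
  shows "deriv_at (rep \<C> C) w v = (0, snd v)"
proof -
  have "((\<lambda>w :: 'e \<times> 'e. (0 :: 'e, snd w)) has_derivative (\<lambda>v. (0, snd v))) (at w)"
    by (rule has_derivative_Pair[OF has_derivative_const has_derivative_snd[OF has_derivative_ident]])
  then show ?thesis
    using deriv_at_cong[OF img_open[OF assms(1)] assms(2) rep_liouville[OF assms(1)]] by (simp add: deriv_at_eqI)
qed

lemma VF_eq_repI:
  assumes "X \<in> VF" "Y \<in> VF" "\<And>C w. C \<in> B \<Longrightarrow> w \<in> chart_img C \<Longrightarrow> rep X C w = rep Y C w"
  shows "X = Y"
proof (rule VF_eqI[OF assms(1,2)])
  fix u C assume C: "C \<in> charts_at B u"
  show "X u C = Y u C"
    using assms(3)[OF charts_atD(1)[OF C] charts_at_img[OF C]] charts_at_inv_map[OF C] by simp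
qed

text \<open>The Nijenhuis tensor of \<open>J\<close> vanishes, since \<open>J\<close> has constant components in induced charts and
\<open>J J = 0\<close>.\<close>

lemma J_integrable:
  assumes "X \<in> VF" "Y \<in> VF"
  shows "br (J X) (J Y) = J (br (J X) Y) + J (br X (J Y))"
proof (rule VF_eq_repI)
  fix C w assume C: "C \<in> B" "w \<in> chart_img C"
  show "rep (br (J X) (J Y)) C w = rep (J (br (J X) Y) + J (br X (J Y))) C w"
    using assms C by (simp add: rep_bracket deriv_rep_J[unfolded J_apply] J_apply)
qed (use assms in \<open>auto intro: bracket_VF J_VF VF_add\<close>)

lemma bracket_liouville_J:
  assumes "X \<in> VF"
  shows "br \<C> (J X) = J (br \<C> X) - J X"
proof (rule VF_eq_repI)
  fix C w assume C: "C \<in> B" "w \<in> chart_img C"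
  show "rep (br \<C> (J X)) C w = rep (J (br \<C> X) - J X) C w"
    using assms C by (simp add: rep_bracket deriv_rep_J[unfolded J_apply] J_apply deriv_rep_liouville)
qed (use assms in \<open>auto intro: bracket_VF J_VF VF_diff liouville_VF\<close>)

text \<open>In a chart, \<open>J (DZ \<cdot> S) = D(J Z) \<cdot> S = 0\<close> and \<open>J (DS \<cdot> Z) = D(J S) \<cdot> Z = D\<C> \<cdot> Z\<close>, which is \<open>Z\<close> itself as \<open>Z\<close> is
vertical. Thus \<open>- [S,_]\<close> is a right inverse of \<open>J\<close> on vertical fields.\<close>

lemma J_bracket_semispray:
  assumes "S \<in> VF" "J S = \<C>" "Z \<in> VF" "J Z = 0"
  shows "J (br S Z) = - Z"
proof (rule VF_eq_repI)
  fix C w assume C: "C \<in> B" "w \<in> chart_img C"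
  have "fst (deriv_at (rep S C) w v) = snd v" for v
    using deriv_rep_J[OF assms(1) C] deriv_rep_liouville[OF C] by (simp add: assms(2))
  moreover have "fst (deriv_at (rep Z C) w v) = 0" for v
    using deriv_rep_J[OF assms(3) C, of v] by (simp add: assms(4) zero_prod_def)
  moreover have "fst (rep Z C w) = 0"
    using J_apply[of Z "chart_inv C w" C] by (simp add: assms(4) zero_prod_def)
  ultimately show "rep (J (br S Z)) C w = rep (- Z) C w"
    using C by (simp add: rep_bracket J_apply prod_eq_iff)
qed (use assms in \<open>auto intro: bracket_VF J_VF VF_uminus\<close>)

end

section \<open>The horizontal and vertical projectors of a spray\<close>

locale spray_bundle = slit_bundle A
  for A :: "('m, 'e::euclidean_space) chart set" +
  fixes S :: "('m, 'e) slit_vfield"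
  assumes spray: "spray A S"
begin

lemma S_VF: "S \<in> VF" and J_S: "J S = \<C>" and bracket_liouville_S: "br \<C> S = S"
  using spray by (auto simp: spray_def semispray_def)

lemma bracket_S_liouville: "br S \<C> = - S"
  using bracket_swap[of S \<C>] by (simp add: bracket_liouville_S)

lemma J_bracket_S: "Z \<in> VF \<Longrightarrow> J Z = 0 \<Longrightarrow> J (br S Z) = - Z"
  by (rule J_bracket_semispray[OF S_VF J_S])

abbreviation "\<Gamma> \<equiv> lie_tensor B S J"
abbreviation "h \<equiv> hor_proj A S"
abbreviation "v \<equiv> ver_proj A S"

lemma \<Gamma>_eq: "\<Gamma> X = br S (J X) - J (br S X)"
  by (simp add: lie_tensor_def)

lemma \<Gamma>_VF: "X \<in> VF \<Longrightarrow> \<Gamma> X \<in> VF"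
  unfolding \<Gamma>_eq by (intro VF_diff bracket_VF J_VF S_VF)

lemma \<Gamma>_add: "X \<in> VF \<Longrightarrow> Y \<in> VF \<Longrightarrow> \<Gamma> (X + Y) = \<Gamma> X + \<Gamma> Y"
  by (simp add: \<Gamma>_eq J_add bracket_add_right S_VF J_VF)

lemma J_\<Gamma>: "X \<in> VF \<Longrightarrow> J (\<Gamma> X) = - J X"
  using J_bracket_S[OF J_VF J_J, of X] unfolding \<Gamma>_eq J_diff J_J by simp

text \<open>Together with \<open>J (\<Gamma> X) = - J X\<close> this says that \<open>\<Gamma>\<close> is an almost product structure with the vertical
fields as eigenspace for the eigenvalue \<open>1\<close>.\<close>

lemma \<Gamma>_vertical: "Z \<in> VF \<Longrightarrow> J Z = 0 \<Longrightarrow> \<Gamma> Z = Z"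
  using J_bracket_S[of Z] bracket_zero_right[OF S_VF] unfolding \<Gamma>_eq by simp

lemma h_VF: "X \<in> VF \<Longrightarrow> h X \<in> VF" and v_VF: "X \<in> VF \<Longrightarrow> v X \<in> VF"
  unfolding hor_proj_def ver_proj_def by (intro VF_rscale VF_diff VF_add \<Gamma>_VF; assumption)+

lemma h_twice: "h X + h X = X - \<Gamma> X"
  unfolding hor_proj_def by (rule rscale_half)

lemma h_add_v: "h X + v X = X"
  by (intro ext) (simp add: hor_proj_def ver_proj_def vf_scale_def scaleR_right_diff_distrib scaleR_right_distrib
      flip: scaleR_left.add)

lemma h_add: "X \<in> VF \<Longrightarrow> Y \<in> VF \<Longrightarrow> h (X + Y) = h X + h Y"
  and v_add: "X \<in> VF \<Longrightarrow> Y \<in> VF \<Longrightarrow> v (X + Y) = v X + v Y"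
  by (auto simp: \<Gamma>_add hor_proj_def ver_proj_def vf_scale_def fun_eq_iff algebra_simps)

lemma J_v:
  assumes "X \<in> VF"
  shows "J (v X) = 0"
  unfolding ver_proj_def J_scale J_add J_\<Gamma>[OF assms] by (simp add: vf_scale_def fun_eq_iff)

lemma h_vertical: "Z \<in> VF \<Longrightarrow> J Z = 0 \<Longrightarrow> h Z = 0"
  unfolding hor_proj_def by (simp add: \<Gamma>_vertical vf_scale_def fun_eq_iff)

lemma v_vertical: "Z \<in> VF \<Longrightarrow> J Z = 0 \<Longrightarrow> v Z = Z"
  using h_add_v[of Z] h_vertical[of Z] by simp

lemma h_v: "X \<in> VF \<Longrightarrow> h (v X) = 0"
  by (simp add: h_vertical v_VF J_v)

lemma h_h: "X \<in> VF \<Longrightarrow> h (h X) = h X"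
  using h_add[OF h_VF v_VF, of X X] by (simp add: h_add_v h_v)

lemma v_v: "X \<in> VF \<Longrightarrow> v (v X) = v X"
  by (simp add: v_vertical v_VF J_v)

lemma v_h: "X \<in> VF \<Longrightarrow> v (h X) = 0"
  using h_add_v[of "h X"] by (simp add: h_h)

text \<open>Here homogeneity of the spray enters: \<open>[S, \<C>] = - S\<close>, so that \<open>\<Gamma> S = - S\<close>. A general semispray need not
be horizontal.\<close>

lemma h_S: "h S = S"
proof -
  have "\<Gamma> S = - S"
    unfolding \<Gamma>_eq J_S bracket_S_liouville bracket_self J_zero by simp
  then have "h S + h S = S + S" using h_twice[of S] by simp
  then show ?thesis
    unfolding fun_eq_iff plus_fun_apply by (metis scaleR_2 scaleR_cancel_left zero_neq_numeral)
qed

lemma v_S: "v S = 0"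
  using h_add_v[of S] by (simp add: h_S)

lemma v_uminus_S: "v (- S) = 0"
  using v_add[OF S_VF VF_uminus[OF S_VF]] v_vertical[OF VF_zero J_zero] by (simp add: v_S)

abbreviation "nab \<equiv> nabla_field A S"

lemma nabla_VF: "X \<in> VF \<Longrightarrow> nab X \<in> VF"
  unfolding nabla_field_def by (intro VF_add h_VF v_VF bracket_VF S_VF)

lemma J_liouville: "J \<C> = 0"
  using J_J[of S] by (simp add: J_S)

lemma nabla_liouville: "nab \<C> = 0"
  unfolding nabla_field_def h_vertical[OF liouville_VF J_liouville] v_vertical[OF liouville_VF J_liouville]
    bracket_zero_right[OF S_VF] bracket_S_liouville v_uminus_S h_vertical[OF VF_zero J_zero]
  by simp

section \<open>Semi-basic forms\<close>

lemma semi_basic_vertical: "semi_basic A \<theta> \<Longrightarrow> Z \<in> VF \<Longrightarrow> J Z = 0 \<Longrightarrow> \<theta> Z = 0"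
  by (simp add: semi_basic_def vertical_iff)

lemma semi_basic_h:
  assumes "\<theta> \<in> one_forms B" "semi_basic A \<theta>" "X \<in> VF"
  shows "\<theta> (h X) = \<theta> X"
  using form_add[OF assms(1) h_VF[OF assms(3)] v_VF[OF assms(3)]]
    semi_basic_vertical[OF assms(2) v_VF[OF assms(3)] J_v[OF assms(3)]]
  unfolding h_add_v by simp

text \<open>A semi-basic form satisfies \<open>i\<^sub>h \<theta> = \<theta>\<close>, so \<open>d\<^sub>h \<theta> = i\<^sub>h d\<theta> - d\<theta>\<close>.\<close>

lemma d_h_semi_basic:
  assumes "\<theta> \<in> one_forms B" "semi_basic A \<theta>" "X \<in> VF" "Y \<in> VF"
  shows "d_along1 B h \<theta> X Y = d1 \<theta> (h X) Y + d1 \<theta> X (h Y) - d1 \<theta> X Y"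
proof -
  have "form1_eq B (insert1 h \<theta>) \<theta>"
    using semi_basic_h[OF assms(1,2)] by (simp add: form1_eq_def insert1_def)
  then show ?thesis
    using ext_d1_cong[OF _ assms(3,4)] by (simp add: d_along1_def insert2_def)
qed

text \<open>A semi-basic form satisfies \<open>i\<^sub>J \<theta> = 0\<close>, so \<open>d\<^sub>J \<theta> = i\<^sub>J d\<theta>\<close>.\<close>

lemma d_J_semi_basic:
  assumes "semi_basic A \<theta>" "X \<in> VF" "Y \<in> VF"
  shows "d_along1 B J \<theta> X Y = d1 \<theta> (J X) Y + d1 \<theta> X (J Y)"
proof -
  have "form1_eq B (insert1 J \<theta>) (\<lambda>_. 0)"
    using semi_basic_vertical[OF assms(1) J_VF J_J] by (simp add: form1_eq_def insert1_def)
  then show ?thesis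
    using ext_d1_cong[OF _ assms(2,3)] by (simp add: d_along1_def insert2_def ext_d1_def[of _ "\<lambda>_. 0"] app_zero_right)
qed

section \<open>From Lagrangians to semi-basic forms\<close>

lemma poincare_cartan_apply: "poincare_cartan A L X = app (J X) L"
  by (simp add: poincare_cartan_def d_along0_def insert1_def ext_d0_def insert0_def app_zero_right)

lemma poincare_cartan_one_form: "L \<in> SF \<Longrightarrow> poincare_cartan A L \<in> one_forms B"
  by (simp add: one_forms_def poincare_cartan_apply app_SF J_VF J_add app_add_left J_scale app_scale_left)

lemma poincare_cartan_semi_basic: "L \<in> SF \<Longrightarrow> semi_basic A (poincare_cartan A L)"
  by (simp add: semi_basic_def vertical_iff poincare_cartan_apply app_zero_left)

text \<open>The degree drops by one because \<open>\<L>\<^sub>\<C> J = - J\<close>.\<close>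

lemma poincare_cartan_homogeneous:
  assumes L: "L \<in> SF" and hom: "homogeneous_function A k L"
  shows "homogeneous_form1 A (k - 1) (poincare_cartan A L)"
proof -
  have "app \<C> (app (J X) L) - app (J (br \<C> X)) L = (\<lambda>u. real_of_int (k - 1) * app (J X) L u)" if X: "X \<in> VF" for X
  proof -
    have "app \<C> (app (J X) L) = app (br \<C> (J X)) L + app (J X) (app \<C> L)"
      using app_bracket[OF liouville_VF J_VF[OF X] L] by simp
    moreover have "app (J X) (app \<C> L) = (\<lambda>u. real_of_int k * app (J X) L u)"
      using hom app_cmult_right[OF J_VF[OF X] L] by (simp add: homogeneous_function_def)
    moreover have "app (br \<C> (J X)) L + app (J X) L = app (J (br \<C> X)) L"
      using app_add_left[OF bracket_VF[OF liouville_VF J_VF[OF X]] J_VF[OF X] L]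
      by (simp add: bracket_liouville_J[OF X])
    ultimately show ?thesis
      by (simp add: fun_eq_iff algebra_simps)
  qed
  then show ?thesis
    by (simp add: homogeneous_form1_def form1_eq_def lie_form1_def poincare_cartan_apply)
qed

text \<open>For \<open>\<theta> = d\<^sub>J L\<close> the left-hand side is the Nijenhuis tensor of \<open>J\<close> on \<open>(X, Y)\<close> applied to \<open>L\<close>.\<close>

lemma poincare_cartan_d_J:
  assumes L: "L \<in> SF" and XY: "X \<in> VF" "Y \<in> VF"
  shows "d1 (poincare_cartan A L) (J X) Y + d1 (poincare_cartan A L) X (J Y) = 0"
proof -
  have "app (br (J X) (J Y)) L = app (J (br (J X) Y)) L + app (J (br X (J Y))) L"
    unfolding J_integrable[OF XY] using XY L by (intro app_add_left J_VF bracket_VF)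
  then show ?thesis
    using app_bracket[OF J_VF[OF XY(1)] J_VF[OF XY(2)] L]
    unfolding ext_d1_def poincare_cartan_apply J_J app_zero_left[OF L] app_zero_right
    by (simp add: algebra_simps)
qed

text \<open>The Lie derivative along \<open>S\<close> of \<open>i\<^sub>J \<omega> = 0\<close>, where \<open>\<omega> = d\<theta>\<close> is \<open>S\<close>-invariant, is \<open>i\<^sub>\<Gamma> \<omega> = 0\<close>; and
\<open>\<Gamma> = Id - 2 h\<close> with \<open>i\<^sub>I\<^sub>d \<omega> = 2 \<omega>\<close>.\<close>

lemma invariant_d_h:
  assumes \<theta>: "\<theta> \<in> one_forms B"
    and inv: "\<And>X Y. X \<in> VF \<Longrightarrow> Y \<in> VF \<Longrightarrow> app S (d1 \<theta> X Y) = d1 \<theta> (br S X) Y + d1 \<theta> X (br S Y)"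
    and d_J: "\<And>X Y. X \<in> VF \<Longrightarrow> Y \<in> VF \<Longrightarrow> d1 \<theta> (J X) Y + d1 \<theta> X (J Y) = 0"
    and XY: "X \<in> VF" "Y \<in> VF"
  shows "d1 \<theta> (h X) Y + d1 \<theta> X (h Y) = d1 \<theta> X Y"
proof -
  note VF = XY J_VF[OF XY(1)] J_VF[OF XY(2)] bracket_VF[OF S_VF] S_VF J_VF \<Gamma>_VF h_VF
  have "0 = app S (d1 \<theta> (J X) Y + d1 \<theta> X (J Y))"
    by (simp add: d_J XY app_zero_right)
  also have "\<dots> = d1 \<theta> (br S (J X)) Y + d1 \<theta> (J X) (br S Y) + (d1 \<theta> (br S X) (J Y) + d1 \<theta> X (br S (J Y)))"
    by (simp add: app_add_right ext_d1_SF \<theta> VF inv)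
  finally have 1: "0 = d1 \<theta> (br S (J X)) Y + d1 \<theta> (J X) (br S Y) + (d1 \<theta> (br S X) (J Y) + d1 \<theta> X (br S (J Y)))" .
  have 2: "d1 \<theta> (\<Gamma> X) Y = d1 \<theta> (br S (J X)) Y - d1 \<theta> (J (br S X)) Y"
    unfolding \<Gamma>_eq by (rule ext_d1_diff_left[OF \<theta>]) (simp_all add: VF)
  have 3: "d1 \<theta> X (\<Gamma> Y) = d1 \<theta> X (br S (J Y)) - d1 \<theta> X (J (br S Y))"
    unfolding \<Gamma>_eq by (rule ext_d1_diff_right[OF \<theta>]) (simp_all add: VF)
  have 4: "d1 \<theta> (J (br S X)) Y + d1 \<theta> (br S X) (J Y) = 0" "d1 \<theta> (J X) (br S Y) + d1 \<theta> X (J (br S Y)) = 0"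
    by (simp_all add: d_J VF)
  have 5: "d1 \<theta> (h X) Y + d1 \<theta> (h X) Y = d1 \<theta> X Y - d1 \<theta> (\<Gamma> X) Y"
    using ext_d1_add_left[OF \<theta> h_VF[OF XY(1)] h_VF[OF XY(1)] XY(2)]
      ext_d1_diff_left[OF \<theta> XY(1) \<Gamma>_VF[OF XY(1)] XY(2)] by (simp add: h_twice)
  have 6: "d1 \<theta> X (h Y) + d1 \<theta> X (h Y) = d1 \<theta> X Y - d1 \<theta> X (\<Gamma> Y)"
    using ext_d1_add_right[OF \<theta> XY(1) h_VF[OF XY(2)] h_VF[OF XY(2)]]
      ext_d1_diff_right[OF \<theta> XY \<Gamma>_VF[OF XY(2)]] by (simp add: h_twice)
  show ?thesis
  proof
    fix u
    show "(d1 \<theta> (h X) Y + d1 \<theta> X (h Y)) u = d1 \<theta> X Y u"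
      using fun_cong[OF 1, of u] fun_cong[OF 2, of u] fun_cong[OF 3, of u] fun_cong[OF 4(1), of u]
        fun_cong[OF 4(2), of u] fun_cong[OF 5, of u] fun_cong[OF 6, of u]
      by simp
  qed
qed

text \<open>By the assumption on \<open>h\<close>, \<open>\<omega> = d\<theta>\<close> vanishes on two horizontal and on two vertical fields, so \<open>\<omega>(X, Y)\<close> is
the sum of \<open>\<omega>(hX, vY)\<close> and \<open>\<omega>(vX, hY)\<close>. Differentiating these along \<open>S\<close> by invariance, only \<open>h[S,hX]\<close> and
\<open>v[S,vX]\<close> (and the same for \<open>Y\<close>) survive in the arguments, and these are the parts of \<open>\<nabla>X\<close>.\<close>

lemma invariant_nabla:
  assumes \<theta>: "\<theta> \<in> one_forms B"
    and inv: "\<And>X Y. X \<in> VF \<Longrightarrow> Y \<in> VF \<Longrightarrow> app S (d1 \<theta> X Y) = d1 \<theta> (br S X) Y + d1 \<theta> X (br S Y)"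
    and d_h: "\<And>X Y. X \<in> VF \<Longrightarrow> Y \<in> VF \<Longrightarrow> d1 \<theta> (h X) Y + d1 \<theta> X (h Y) = d1 \<theta> X Y"
    and XY: "X \<in> VF" "Y \<in> VF"
  shows "nabla_form2 A S (d1 \<theta>) X Y = 0"
proof -
  let ?w = "d1 \<theta>"
  have hh: "?w (h X) (h Y) = 0" if "X \<in> VF" "Y \<in> VF" for X Y
    using d_h[OF h_VF[OF that(1)] h_VF[OF that(2)]] by (simp add: h_h that)
  have vv: "?w (v X) (v Y) = 0" if "X \<in> VF" "Y \<in> VF" for X Y
    using d_h[OF v_VF[OF that(1)] v_VF[OF that(2)]]
    by (simp add: h_v that ext_d1_zero_left[OF \<theta>] ext_d1_zero_right[OF \<theta>] v_VF)
  have left_h: "?w Z (h Y) = ?w (v Z) (h Y)" and left_v: "?w Z (v Y) = ?w (h Z) (v Y)"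
    and right_h: "?w (h Y) Z = ?w (h Y) (v Z)" and right_v: "?w (v Y) Z = ?w (v Y) (h Z)"
    if "Z \<in> VF" "Y \<in> VF" for Y Z
    using ext_d1_add_left[OF \<theta> h_VF[OF that(1)] v_VF[OF that(1)] h_VF[OF that(2)]]
      ext_d1_add_left[OF \<theta> h_VF[OF that(1)] v_VF[OF that(1)] v_VF[OF that(2)]]
      ext_d1_add_right[OF \<theta> h_VF[OF that(2)] h_VF[OF that(1)] v_VF[OF that(1)]]
      ext_d1_add_right[OF \<theta> v_VF[OF that(2)] h_VF[OF that(1)] v_VF[OF that(1)]]
      hh[OF that] vv[OF that] hh[OF that(2,1)] vv[OF that(2,1)]
    by (simp_all add: h_add_v)
  have split: "?w Z W = ?w (h Z) (v W) + ?w (v Z) (h W)" if "Z \<in> VF" "W \<in> VF" for Z W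
    using ext_d1_add_left[OF \<theta> h_VF[OF that(1)] v_VF[OF that(1)] that(2)]
    by (simp add: h_add_v right_h[OF that(2,1)] right_v[OF that(2,1)])
  note VF = XY h_VF v_VF bracket_VF[OF S_VF] nabla_VF
  have "app S (?w X Y) = app S (?w (h X) (v Y)) + app S (?w (v X) (h Y))"
    unfolding split[OF XY] by (rule app_add_right[OF S_VF]) (simp_all add: ext_d1_SF \<theta> VF)
  also have "app S (?w (h X) (v Y)) = ?w (h (br S (h X))) (v Y) + ?w (h X) (v (br S (v Y)))"
    using left_v[of "br S (h X)" Y] right_h[of "br S (v Y)" X] by (simp add: inv VF)
  also have "app S (?w (v X) (h Y)) = ?w (v (br S (v X))) (h Y) + ?w (v X) (h (br S (h Y)))"
    using left_h[of "br S (v X)" Y] right_v[of "br S (h Y)" X] by (simp add: inv VF)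
  finally have 1: "app S (?w X Y) = ?w (h (br S (h X))) (v Y) + ?w (h X) (v (br S (v Y)))
    + (?w (v (br S (v X))) (h Y) + ?w (v X) (h (br S (h Y))))" .
  have h_nab: "h (nab Z) = h (br S (h Z))" and v_nab: "v (nab Z) = v (br S (v Z))" if "Z \<in> VF" for Z
    using that unfolding nabla_field_def by (simp_all add: h_add v_add VF h_h h_v v_h v_v)
  show ?thesis
    using 1 split[OF nabla_VF[OF XY(1)] XY(2)] split[OF XY(1) nabla_VF[OF XY(2)]]
    by (simp add: nabla_form2_def h_nab v_nab XY fun_eq_iff)
qed

theorem lagrangian_imp_form:
  assumes hom: "homogeneous_function A k L" and ind: "lagrangian_induces A L S"
  defines "\<theta> \<equiv> poincare_cartan A L"
  shows "\<theta> \<in> one_forms B" "homogeneous_form1 A (k - 1) \<theta>" "semi_basic A \<theta>"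
    "form2_zero B (d_along1 B h \<theta>)" "form2_zero B (d_along1 B J \<theta>)" "form2_zero B (nabla_form2 A S (d1 \<theta>))"
proof -
  have L: "L \<in> SF" and eq: "form1_eq B (lie_form1 B S \<theta>) (ext_d0 B L)"
    using ind by (auto simp: lagrangian_induces_def \<theta>_def)
  show form: "\<theta> \<in> one_forms B" and "homogeneous_form1 A (k - 1) \<theta>" and sb: "semi_basic A \<theta>"
    unfolding \<theta>_def using L hom
    by (simp_all add: poincare_cartan_one_form poincare_cartan_homogeneous poincare_cartan_semi_basic)
  note inv = lie_invariant_ext_d1[OF form L S_VF eq]
  have d_J: "d1 \<theta> (J X) Y + d1 \<theta> X (J Y) = 0" if "X \<in> VF" "Y \<in> VF" for X Y
    unfolding \<theta>_def by (rule poincare_cartan_d_J[OF L that])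
  note d_h = invariant_d_h[OF form inv d_J]
  show "form2_zero B (d_along1 B h \<theta>)"
    by (simp add: form2_zero_def d_h_semi_basic[OF form sb] d_h)
  show "form2_zero B (d_along1 B J \<theta>)"
    by (simp add: form2_zero_def d_J_semi_basic[OF sb] d_J)
  show "form2_zero B (nabla_form2 A S (d1 \<theta>))"
    by (simp add: form2_zero_def invariant_nabla[OF form inv d_h])
qed

section \<open>From semi-basic forms to Lagrangians\<close>

text \<open>For \<open>\<theta> = d\<^sub>J L\<close> with \<open>L\<close> homogeneous of degree \<open>k\<close>, Euler's theorem reads \<open>\<theta>(S) = \<C>(L) = k L\<close>; this forces
the choice of \<open>L\<close>.\<close>

theorem form_imp_lagrangian:
  assumes form: "\<theta> \<in> one_forms B" and hom: "homogeneous_form1 A (k - 1) \<theta>" and sb: "semi_basic A \<theta>"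
    and d_h: "form2_zero B (d_along1 B h \<theta>)" and d_J: "form2_zero B (d_along1 B J \<theta>)"
    and nab: "k \<noteq> 1 \<Longrightarrow> form2_zero B (nabla_form2 A S (d1 \<theta>))" and k: "k \<noteq> 0"
  defines "L \<equiv> (\<lambda>u. (1 / real_of_int k) * \<theta> S u)"
  shows "homogeneous_function A k L" "lagrangian_induces A L S"
proof -
  let ?k = "real_of_int k"
  have \<theta>S: "\<theta> S \<in> SF" by (rule form_SF[OF form S_VF])
  have L: "L \<in> SF" unfolding L_def by (rule SF_cmult[OF \<theta>S])
  have \<theta>SL: "\<theta> S = (\<lambda>u. ?k * L u)" using k by (simp add: L_def)
  have lie: "app \<C> (\<theta> X) u = (?k - 1) * \<theta> X u + \<theta> (br \<C> X) u" if "X \<in> VF" for X u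
  proof -
    have "app \<C> (\<theta> X) - \<theta> (br \<C> X) = (\<lambda>u. real_of_int (k - 1) * \<theta> X u)"
      using hom that by (simp add: homogeneous_form1_def form1_eq_def lie_form1_def)
    from fun_cong[OF this, of u] show ?thesis by (simp add: algebra_simps)
  qed
  have "app \<C> (\<theta> S) = (\<lambda>u. ?k * \<theta> S u)"
    using lie[OF S_VF] by (simp add: bracket_liouville_S fun_eq_iff algebra_simps)
  then show "homogeneous_function A k L"
    unfolding homogeneous_function_def using app_cmult_right[OF liouville_VF \<theta>S, of "1 / ?k"]
    by (simp add: L_def fun_eq_iff)
  have vert: "\<theta> Z = 0" if "Z \<in> VF" "J Z = 0" for Z by (rule semi_basic_vertical[OF sb that])
  have i_C: "d1 \<theta> \<C> Y = (\<lambda>u. (?k - 1) * \<theta> Y u)" if "Y \<in> VF" for Y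
    by (intro ext) (simp add: ext_d1_def vert[OF liouville_VF J_liouville] app_zero_right lie[OF that])
  have \<theta>_bracket_J: "\<theta> (br S (J Y)) = - \<theta> Y" if "Y \<in> VF" for Y
  proof -
    have "\<theta> (br S (J Y) + Y) = 0"
      using J_bracket_S[OF J_VF[OF that] J_J] that by (intro vert VF_add bracket_VF S_VF J_VF) (simp_all add: J_add)
    then show ?thesis
      using form_add[OF form bracket_VF[OF S_VF J_VF[OF that]] that] by (simp add: eq_neg_iff_add_eq_0)
  qed
  have J_L: "app (J Y) L = \<theta> Y" if Y: "Y \<in> VF" for Y
  proof -
    have 1: "d1 \<theta> \<C> Y + d1 \<theta> S (J Y) = 0"
      using d_J d_J_semi_basic[OF sb S_VF Y] S_VF Y by (simp add: form2_zero_def J_S)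
    have 2: "d1 \<theta> S (J Y) = \<theta> Y - app (J Y) (\<theta> S)"
      using vert[OF J_VF[OF Y] J_J] by (simp add: ext_d1_def app_zero_right \<theta>_bracket_J[OF Y])
    have 3: "app (J Y) (\<theta> S) = (\<lambda>u. ?k * app (J Y) L u)"
      unfolding \<theta>SL by (rule app_cmult_right[OF J_VF[OF Y] L])
    have "?k * app (J Y) L u = ?k * \<theta> Y u" for u
      using fun_cong[OF 1, of u] fun_cong[OF 2, of u] fun_cong[OF 3, of u] fun_cong[OF i_C[OF Y], of u]
      by (auto simp: algebra_simps)
    then show ?thesis using k by (simp add: fun_eq_iff)
  qed
  \<comment> \<open>On vertical fields \<open>\<L>\<^sub>S \<theta> = dL\<close> follows from \<open>d\<^sub>J L = \<theta>\<close>, since \<open>vY = J(- [S, vY])\<close>.\<close>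
  have v_L: "app S (\<theta> (v Y)) - \<theta> (br S (v Y)) = app (v Y) L" if Y: "Y \<in> VF" for Y
  proof -
    have V: "br S (v Y) \<in> VF" by (rule bracket_VF[OF S_VF v_VF[OF Y]])
    have "v Y = J (- br S (v Y))"
      using J_bracket_S[OF v_VF[OF Y] J_v[OF Y]] by (simp add: J_uminus)
    then have "app (v Y) L = - \<theta> (br S (v Y))"
      using J_L[OF VF_uminus[OF V]] form_uminus[OF form V] by simp
    then show ?thesis using vert[OF v_VF[OF Y] J_v[OF Y]] by (simp add: app_zero_right)
  qed
  \<comment> \<open>On horizontal fields \<open>(\<L>\<^sub>S \<theta>)(hY) = k hY(L)\<close> by \<open>d\<^sub>h \<theta> = 0\<close>; for \<open>k \<noteq> 1\<close> the left-hand side vanishes.\<close>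
  have h_L: "app S (\<theta> (h Y)) - \<theta> (br S (h Y)) = app (h Y) L" if Y: "Y \<in> VF" for Y
  proof -
    have "d1 \<theta> S (h Y) = 0"
      using d_h d_h_semi_basic[OF form sb S_VF Y] S_VF Y by (simp add: form2_zero_def h_S)
    then have *: "app S (\<theta> (h Y)) - \<theta> (br S (h Y)) = (\<lambda>u. ?k * app (h Y) L u)"
      using app_cmult_right[OF h_VF[OF Y] L, of ?k] unfolding ext_d1_def \<theta>SL[symmetric] by (simp add: algebra_simps)
    show ?thesis
    proof (cases "k = 1")
      case True
      then show ?thesis using * by simp
    next
      case False
      \<comment> \<open>Contracting \<open>\<nabla> d\<theta>\<close> with \<open>\<C>\<close> gives \<open>(k - 1) \<nabla>\<theta>\<close>, because \<open>i\<^sub>\<C> d\<theta> = (k - 1) \<theta>\<close> and \<open>\<nabla>\<C> = 0\<close>.\<close>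
      have "nabla_form2 A S (d1 \<theta>) \<C> Y = 0"
        using nab[OF False] liouville_VF Y by (simp add: form2_zero_def)
      then have eq: "app S (d1 \<theta> \<C> Y) = d1 \<theta> \<C> (nab Y)"
        unfolding nabla_form2_def nabla_liouville ext_d1_zero_left[OF form Y] by simp
      have "(?k - 1) * app S (\<theta> Y) u = (?k - 1) * \<theta> (nab Y) u" for u
        using fun_cong[OF eq, of u] fun_cong[OF app_cmult_right[OF S_VF form_SF[OF form Y], of "?k - 1"], of u]
        by (simp add: i_C Y nabla_VF)
      then have "app S (\<theta> Y) = \<theta> (nab Y)" using False by (simp add: fun_eq_iff)
      also have "\<dots> = \<theta> (h (br S (h Y))) + \<theta> (v (br S (v Y)))"
        unfolding nabla_field_def by (intro form_add[OF form] h_VF v_VF bracket_VF S_VF Y)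
      also have "\<dots> = \<theta> (br S (h Y))"
        using Y vert[OF v_VF J_v, of "br S (v Y)"] by (simp add: semi_basic_h[OF form sb] bracket_VF S_VF h_VF v_VF)
      finally have "app S (\<theta> (h Y)) - \<theta> (br S (h Y)) = 0"
        by (simp add: semi_basic_h[OF form sb Y])
      then show ?thesis using * k by (simp add: fun_eq_iff)
    qed
  qed
  have "app S (\<theta> Y) - \<theta> (br S Y) = app Y L" if Y: "Y \<in> VF" for Y
  proof -
    have "app (h Y + v Y) L = app (h Y) L + app (v Y) L"
      by (rule app_add_left[OF h_VF[OF Y] v_VF[OF Y] L])
    moreover have "\<theta> (br S (h Y + v Y)) = \<theta> (br S (h Y)) + \<theta> (br S (v Y))"
      using form_add[OF form bracket_VF[OF S_VF h_VF[OF Y]] bracket_VF[OF S_VF v_VF[OF Y]]]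
      by (simp add: bracket_add_right[OF S_VF h_VF[OF Y] v_VF[OF Y]])
    moreover have "app S (\<theta> Y) = app S (\<theta> (h Y)) + app S (\<theta> (v Y))"
      using semi_basic_h[OF form sb Y] vert[OF v_VF[OF Y] J_v[OF Y]] by (simp add: app_zero_right)
    ultimately show ?thesis
      using h_L[OF Y] v_L[OF Y] unfolding h_add_v by (simp add: algebra_simps)
  qed
  then show "lagrangian_induces A L S"
    using L by (simp add: lagrangian_induces_def form1_eq_def lie_form1_def ext_d0_def poincare_cartan_apply J_L bracket_VF S_VF)
qed

end

section \<open>Characterisation of homogeneous Lagrangian sprays\<close>

theorem theorem5p4:
  fixes M :: "'m topology"
    and A :: "('m, real ^ 'n) chart set"
    and S :: "('m, real ^ 'n) slit_vfield"
    and k :: int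
  assumes "smooth_manifold M A"
    and "spray A S"
    and "k \<notin> {-1, 0}"
  shows "(\<exists>L. homogeneous_function A k L \<and> lagrangian_induces A L S) \<longleftrightarrow>
    (\<exists>\<theta>\<in>one_forms (slit_atlas A). homogeneous_form1 A (k - 1) \<theta> \<and> semi_basic A \<theta> \<and>
      (k = 1 \<longrightarrow>
        form2_zero (slit_atlas A) (d_along1 (slit_atlas A) (hor_proj A S) \<theta>) \<and>
        form2_zero (slit_atlas A) (d_along1 (slit_atlas A) tangent_structure \<theta>)) \<and>
      (k \<notin> {-1, 0, 1} \<longrightarrow>
        form2_zero (slit_atlas A) (d_along1 (slit_atlas A) (hor_proj A S) \<theta>) \<and>
        form2_zero (slit_atlas A) (d_along1 (slit_atlas A) tangent_structure \<theta>) \<and>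
        form2_zero (slit_atlas A) (nabla_form2 A S (ext_d1 (slit_atlas A) \<theta>))))"
    (is "?L \<longleftrightarrow> ?R")
proof -
  interpret base: smooth_atlas A
    by (rule smooth_manifold_imp_smooth_atlas[OF assms(1)])
  interpret spray_bundle A S
    by unfold_locales (rule assms(2))
  show ?thesis
  proof
    assume ?L
    then show ?R using lagrangian_imp_form by blast
  next
    assume ?R
    then obtain \<theta> where \<theta>: "\<theta> \<in> one_forms B" "homogeneous_form1 A (k - 1) \<theta>" "semi_basic A \<theta>"
      "form2_zero B (d_along1 B h \<theta>)" "form2_zero B (d_along1 B J \<theta>)"
      and n: "k \<noteq> 1 \<Longrightarrow> form2_zero B (nabla_form2 A S (d1 \<theta>))"
      using assms(3) by auto
    show ?L
      using form_imp_lagrangian[OF \<theta> n] assms(3) by auto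
  qed
qed

end
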